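(* Let $a,b,c$ be positive integers, let $p$ be a prime number, and let $K$ be an infinite field with $\operatorname{char}(K)=p$. Then the number of plane partitions contained inside an $a\times b\times c$ box is divisible by $p$ if and only if the algebra $K[x,y,z]/(x^{a+b},y^{a+c},z^{b+c})$ fails to have the Weak Lefschetz Property.
   Context: A plane partition is a finite two-dimensional array $(a_{i,j})$ of positive integers, non-increasing from left to right and from top to bottom, i.e. $a_{i,j}\ge a_{i,j+1}$ and $a_{i,j}\ge a_{i+1,j}$ whenever the entries exist. It is contained inside an $a\times b\times c$ box if $1\le i\le a$, $1\le j\le b$ and $a_{i,j}\le c$ for all entries; the empty plane partition is counted. (Equivalently, one counts $a\times b$ matrices with entries in $\{0,1,\dots,c\}$ that are weakly decreasing along rows and columns.) A standard graded artinian $K$-algebra $A=\bigoplus_d A_d$ has the Weak Lefschetz Property if there is a linear form $L$ such that, for all $i$, the multiplication map $\times L:A_i\to A_{i+1}$ has maximal rank (i.e. is injective or surjective). *)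

theory Defs
  imports "HOL-Library.Poly_Mapping" "HOL-Algebra.Algebraic_Closure_Type"
begin

section \<open>Plane partitions\<close>

text \<open>
  A plane partition is encoded as the extension by zero of the array of its entries: \<open>\<pi> i j = 0\<close>
  means that there is no entry at position \<open>(i, j)\<close>, and the entries are the positive values of
  \<open>\<pi>\<close>. Rows and columns are numbered from \<open>0\<close>. Monotonicity of the extension expresses both
  monotonicity of the array and the fact that its shape is a Young diagram.
\<close>

definition plane_partition :: "(nat \<Rightarrow> nat \<Rightarrow> nat) \<Rightarrow> bool" where
  "plane_partition \<pi> \<longleftrightarrow>
     finite {(i, j). \<pi> i j > 0} \<and>
     (\<forall>i j. \<pi> i (Suc j) \<le> \<pi> i j) \<and>
     (\<forall>i j. \<pi> (Suc i) j \<le> \<pi> i j)"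

definition in_box :: "nat \<Rightarrow> nat \<Rightarrow> nat \<Rightarrow> (nat \<Rightarrow> nat \<Rightarrow> nat) \<Rightarrow> bool" where
  "in_box a b c \<pi> \<longleftrightarrow> (\<forall>i j. \<pi> i j > 0 \<longrightarrow> i < a \<and> j < b \<and> \<pi> i j \<le> c)"

definition plane_partitions_in_box :: "nat \<Rightarrow> nat \<Rightarrow> nat \<Rightarrow> (nat \<Rightarrow> nat \<Rightarrow> nat) set" where
  "plane_partitions_in_box a b c = {\<pi>. plane_partition \<pi> \<and> in_box a b c \<pi>}"

lemma finite_plane_partitions_in_box: "finite (plane_partitions_in_box a b c)"
proof -
  let ?F = "{f. \<forall>x. (x \<in> {..<a} \<times> {..<b} \<longrightarrow> f x \<in> {..c}) \<and> (x \<notin> {..<a} \<times> {..<b} \<longrightarrow> f x = 0)}"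
  have "finite ?F"
    by (rule finite_set_of_finite_funs) auto
  moreover have "plane_partitions_in_box a b c \<subseteq> curry ` ?F"
  proof
    fix \<pi> assume "\<pi> \<in> plane_partitions_in_box a b c"
    then have "in_box a b c \<pi>"
      by (simp add: plane_partitions_in_box_def)
    then have *: "\<pi> i j > 0 \<Longrightarrow> i < a \<and> j < b \<and> \<pi> i j \<le> c" for i j
      by (simp add: in_box_def)
    have "\<pi> i j \<le> c" for i j
      using *[of i j] by (cases "\<pi> i j") auto
    moreover have "\<pi> i j = 0" if "\<not> (i < a \<and> j < b)" for i j
      using *[of i j] that by auto
    ultimately have "case_prod \<pi> \<in> ?F"
      by auto
    then show "\<pi> \<in> curry ` ?F"
      by (intro image_eqI[of _ _ "case_prod \<pi>"]) simp_all
  qed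
  ultimately show ?thesis
    using finite_surj by blast
qed


section \<open>Polynomials in several variables and their quotients\<close>

text \<open>Polynomials over \<open>'k\<close> in variables from \<open>'v\<close>, as finitely supported functions on monomials.\<close>

type_synonym ('v, 'k) multipoly = "('v \<Rightarrow>\<^sub>0 nat) \<Rightarrow>\<^sub>0 'k"

definition indet :: "'v \<Rightarrow> ('v, 'k::comm_semiring_1) multipoly" where
  "indet v = Poly_Mapping.single (Poly_Mapping.single v 1) 1"

definition monomial_degree :: "('v \<Rightarrow>\<^sub>0 nat) \<Rightarrow> nat" where
  "monomial_degree m = (\<Sum>v\<in>Poly_Mapping.keys m. Poly_Mapping.lookup m v)"

text \<open>The zero polynomial is homogeneous of every degree.\<close>

definition homogeneous :: "nat \<Rightarrow> ('v, 'k::zero) multipoly \<Rightarrow> bool" where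
  "homogeneous d f \<longleftrightarrow> (\<forall>m\<in>Poly_Mapping.keys f. monomial_degree m = d)"

definition quotient_algebra ::
  "('v, 'k::comm_ring_1) multipoly set \<Rightarrow> ('v, 'k) multipoly set ring" where
  "quotient_algebra S = ring_of_type_algebra Quot (genideal ring_of_type_algebra S)"

definition graded_component ::
  "('v, 'k::comm_ring_1) multipoly set \<Rightarrow> nat \<Rightarrow> ('v, 'k) multipoly set set" where
  "graded_component S d =
     {genideal ring_of_type_algebra S +>\<^bsub>ring_of_type_algebra\<^esub> f |f. homogeneous d f}"


section \<open>The Weak Lefschetz Property\<close>

text \<open>\<open>gr d\<close> is the homogeneous component of degree \<open>d\<close> of the graded algebra \<open>A\<close>.\<close>

definition weak_lefschetz :: "('a, 'm) ring_scheme \<Rightarrow> (nat \<Rightarrow> 'a set) \<Rightarrow> bool" where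
  "weak_lefschetz A gr \<longleftrightarrow>
     (\<exists>L\<in>gr 1. \<forall>i. inj_on (\<lambda>u. L \<otimes>\<^bsub>A\<^esub> u) (gr i) \<or> (\<lambda>u. L \<otimes>\<^bsub>A\<^esub> u) ` gr i = gr (Suc i))"


section \<open>Monomial complete intersections in three variables\<close>

datatype xyz = VarX | VarY | VarZ

definition pure_powers :: "nat \<Rightarrow> nat \<Rightarrow> nat \<Rightarrow> (xyz, 'k::comm_ring_1) multipoly set" where
  "pure_powers l m n = {indet VarX ^ l, indet VarY ^ m, indet VarZ ^ n}"

end

theory Submission
  imports Defs "Jordan_Normal_Form.Determinant"
begin

text \<open>
  Let \<open>A\<close> be the algebra \<open>K[x,y,z]/(x^(a+b), y^(a+c), z^(b+c))\<close> and \<open>d = a + b + c - 2\<close>. The proof shows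
  that \<open>A\<close> has the Weak Lefschetz Property if and only if the number of plane partitions, which is an
  \<open>a \<times> a\<close> determinant of binomial coefficients, is nonzero in \<open>K\<close>.
  
  The socle of \<open>A\<close> lies in degree \<open>2d + 1\<close>, which makes multiplication by \<open>L\<close> from \<open>A_d\<close> to \<open>A_(d+1)\<close>
  decisive. Injectivity descends to lower degrees, because below the socle degree only \<open>0\<close> is
  annihilated by all variables (\<open>multiplication_injective_descends\<close>); surjectivity ascends, because \<open>A\<close>
  is generated in degree one (\<open>multiplication_surjective_ascends\<close>); and as the map is its own transpose for
  the pairing of \<open>A_d\<close> with \<open>A_(d+1)\<close> into the socle, surjectivity implies injectivity in the middle
  (\<open>multiplication_surjective_imp_injective\<close>).
  
  For \<open>L = x + y + z\<close> the variable \<open>z\<close> can be eliminated. An element \<open>f_0 + f_1 z + f_2 z^2 + ...\<close> of the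
  kernel satisfies \<open>f_(k-1) = - (x + y) f_k\<close>, so it is determined by its top coefficient \<open>g\<close>, a form of
  degree \<open>a - 1\<close> in \<open>x\<close> and \<open>y\<close>. The one remaining condition is that \<open>(x + y)^(b+c) g\<close> vanishes modulo
  \<open>x^(a+b)\<close> and \<open>y^(a+c)\<close>. In monomial coordinates this is a square linear system whose matrix has the
  entries \<open>(b + c) choose (b + t - s)\<close> for \<open>s, t < a\<close>. So the map is bijective in the middle when
  the determinant of this matrix is nonzero (\<open>det_nonzero_imp_middle_injective\<close> and
  \<open>det_nonzero_imp_middle_surjective\<close>). A general linear form
  reduces to \<open>x + y + z\<close>: if one of its coefficients is \<open>0\<close>, a kernel element in the middle degree can be
  written down, and otherwise the variables can be rescaled (\<open>middle_injective_imp_det_nonzero\<close>).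
  
  That the determinant counts plane partitions follows from a statement for all partitions \<open>\<mu>\<close>, namely
  that the determinant with entries \<open>n choose (\<mu>_i - i + j)\<close> counts the tableaux of shape \<open>\<mu>\<close> with
  entries below \<open>n\<close>, strict rows and weak columns (\<open>card_tableaux\<close>). Both sides satisfy the same recursion
  in \<open>n\<close>. In a tableau, the cells with the largest possible entry are the last cells of some set \<open>S\<close> of rows,
  and they can be removed. In the determinant, Pascal's rule splits every row into two, and multilinearity
  gives a sum over all sets \<open>S\<close> of rows; when removing the last cells of the rows in \<open>S\<close> does not leave a
  partition, the summand has two equal rows or a zero row. A plane partition in the box is such a tableau
  of rectangular shape with \<open>a\<close> rows of length \<open>b\<close>, after a change of coordinates
  (\<open>bij_betw_plane_partitions_tableaux\<close>).
\<close>

section \<open>Determinants of binomial coefficients\<close>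

text \<open>
  With the lower index in the integers, Pascal's rule holds without exception, and a row of the
  matrices below vanishes when it lies entirely to the left of Pascal's triangle.
\<close>
definition zbinom :: "nat \<Rightarrow> int \<Rightarrow> int" where
  "zbinom n k = (if k < 0 then 0 else int (n choose nat k))"

lemma zbinom_Suc: "zbinom (Suc n) k = zbinom n k + zbinom n (k - 1)"
proof (cases "k \<le> 0")
  case True
  then show ?thesis by (cases "k = 0") (auto simp: zbinom_def)
next
  case False
  then have "nat k = Suc (nat (k - 1))" by simp
  then show ?thesis using False by (simp add: zbinom_def)
qed

lemma zbinom_0: "zbinom 0 k = (if k = 0 then 1 else 0)"
  by (auto simp: zbinom_def binomial_eq_0)

text \<open>
  The entry is the elementary symmetric polynomial of degree \<open>\<mu> i - i + j\<close> at \<open>n\<close> ones. For a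
  partition \<open>\<mu>\<close> the determinant is the dual Jacobi-Trudi formula for the Schur polynomial of the conjugate
  of \<open>\<mu>\<close>. Integer parts are allowed so that parts may be decreased without regard to their size.
\<close>
definition binomial_matrix :: "nat \<Rightarrow> nat \<Rightarrow> (nat \<Rightarrow> int) \<Rightarrow> int mat" where
  "binomial_matrix a n \<mu> = mat a a (\<lambda>(i, j). zbinom n (\<mu> i - int i + int j))"

lemma binomial_matrix_carrier: "binomial_matrix a n \<mu> \<in> carrier_mat a a"
  by (simp add: binomial_matrix_def)

lemma det_binomial_matrix:
  "det (binomial_matrix a n \<mu>) =
     (\<Sum>p | p permutes {0..<a}. signof p * (\<Prod>i<a. zbinom n (\<mu> i - int i + int (p i))))"
proof -
  have "(\<Prod>i = 0..<a. binomial_matrix a n \<mu> $$ (i, p i)) =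
        (\<Prod>i<a. zbinom n (\<mu> i - int i + int (p i)))" if "p permutes {0..<a}" for p
    unfolding lessThan_atLeast0
  proof (rule prod.cong)
    fix i assume "i \<in> {0..<a}"
    moreover from this have "p i < a" using permutes_in_image[OF that] by fastforce
    ultimately show "binomial_matrix a n \<mu> $$ (i, p i) = zbinom n (\<mu> i - int i + int (p i))"
      by (simp add: binomial_matrix_def)
  qed simp
  then show ?thesis
    by (simp add: det_def'[OF binomial_matrix_carrier])
qed

text \<open>
  Pascal's rule writes row \<open>i\<close> as the sum of the row for \<open>\<mu> i\<close> and the row for \<open>\<mu> i - 1\<close>. Expanding in all
  rows at once produces one determinant for each set \<open>S\<close> of rows whose part is decreased.
\<close>
lemma det_binomial_matrix_Suc:
  "det (binomial_matrix a (Suc n) \<mu>) =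
     (\<Sum>S\<in>Pow {..<a}. det (binomial_matrix a n (\<lambda>i. \<mu> i - of_bool (i \<in> S))))"
proof -
  have "(\<Prod>i<a. zbinom (Suc n) (\<mu> i - int i + int (p i))) =
        (\<Sum>S\<in>Pow {..<a}. \<Prod>i<a. zbinom n (\<mu> i - of_bool (i \<in> S) - int i + int (p i)))" for p
  proof -
    have "(\<Prod>i<a. zbinom (Suc n) (\<mu> i - int i + int (p i))) =
        (\<Prod>i<a. zbinom n (\<mu> i - 1 - int i + int (p i)) + zbinom n (\<mu> i - int i + int (p i)))"
      by (rule prod.cong) (simp_all add: zbinom_Suc algebra_simps)
    also have "\<dots> = (\<Sum>S\<in>Pow {..<a}. (\<Prod>i\<in>S. zbinom n (\<mu> i - 1 - int i + int (p i))) *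
                      (\<Prod>i\<in>{..<a} - S. zbinom n (\<mu> i - int i + int (p i))))"
      by (rule prod_add) simp
    also have "\<dots> = (\<Sum>S\<in>Pow {..<a}. \<Prod>i<a. zbinom n (\<mu> i - of_bool (i \<in> S) - int i + int (p i)))"
    proof (rule sum.cong)
      fix S assume "S \<in> Pow {..<a}"
      then have S: "S \<subseteq> {..<a}" by simp
      show "(\<Prod>i\<in>S. zbinom n (\<mu> i - 1 - int i + int (p i))) *
              (\<Prod>i\<in>{..<a} - S. zbinom n (\<mu> i - int i + int (p i))) =
            (\<Prod>i<a. zbinom n (\<mu> i - of_bool (i \<in> S) - int i + int (p i)))"
        by (subst prod.subset_diff[OF S, of _]) (simp_all add: mult.commute)
    qed simp
    finally show ?thesis .
  qed
  then have "det (binomial_matrix a (Suc n) \<mu>) =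
     (\<Sum>p | p permutes {0..<a}. \<Sum>S\<in>Pow {..<a}.
        signof p * (\<Prod>i<a. zbinom n (\<mu> i - of_bool (i \<in> S) - int i + int (p i))))"
    by (simp add: det_binomial_matrix sum_distrib_left)
  also have "\<dots> = (\<Sum>S\<in>Pow {..<a}. det (binomial_matrix a n (\<lambda>i. \<mu> i - of_bool (i \<in> S))))"
    by (subst sum.swap) (simp add: det_binomial_matrix)
  finally show ?thesis .
qed

lemma det_binomial_matrix_zero_row:
  assumes "i < a" and "\<And>j. j < a \<Longrightarrow> zbinom n (\<mu> i - int i + int j) = 0"
  shows "det (binomial_matrix a n \<mu>) = 0"
proof -
  have "(\<Prod>i<a. zbinom n (\<mu> i - int i + int (p i))) = 0" if "p permutes {0..<a}" for p
  proof (rule prod_zero)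
    have "p i < a" using permutes_in_image[OF that] assms(1) by fastforce
    then show "\<exists>i\<in>{..<a}. zbinom n (\<mu> i - int i + int (p i)) = 0" using assms by blast
  qed simp
  then show ?thesis unfolding det_binomial_matrix by (intro sum.neutral) auto
qed

text \<open>
  The index \<open>\<mu> i - i\<close> is the same for both rows, so the rows coincide.
\<close>
lemma det_binomial_matrix_ascent:
  assumes "Suc i < a" and "\<mu> (Suc i) = \<mu> i + 1"
  shows "det (binomial_matrix a n \<mu>) = 0"
proof (rule det_identical_rows[OF binomial_matrix_carrier, of i "Suc i"])
  show "row (binomial_matrix a n \<mu>) i = row (binomial_matrix a n \<mu>) (Suc i)"
    using assms by (intro eq_vecI) (simp_all add: binomial_matrix_def)
qed (use assms in simp_all)

section \<open>Tableaux with strict rows and weak columns\<close>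

text \<open>
  The row lengths are the values of \<open>\<mu>\<close> below \<open>a\<close>. Cells outside the shape carry the value \<open>0\<close>, so that a
  tableau is determined by its entries.
\<close>
definition tableaux :: "nat \<Rightarrow> (nat \<Rightarrow> nat) \<Rightarrow> nat \<Rightarrow> (nat \<Rightarrow> nat \<Rightarrow> nat) set" where
  "tableaux a \<mu> n = {u.
     (\<forall>i j. \<not> (i < a \<and> j < \<mu> i) \<longrightarrow> u i j = 0) \<and>
     (\<forall>i j. i < a \<longrightarrow> j < \<mu> i \<longrightarrow> u i j < n) \<and>
     (\<forall>i j. i < a \<longrightarrow> Suc j < \<mu> i \<longrightarrow> u i j < u i (Suc j)) \<and>
     (\<forall>i j. Suc i < a \<longrightarrow> j < \<mu> i \<longrightarrow> j < \<mu> (Suc i) \<longrightarrow> u i j \<le> u (Suc i) j)}"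

definition descending :: "nat \<Rightarrow> (nat \<Rightarrow> nat) \<Rightarrow> bool" where
  "descending a \<mu> \<longleftrightarrow> (\<forall>i. Suc i < a \<longrightarrow> \<mu> (Suc i) \<le> \<mu> i)"

definition shrink :: "(nat \<Rightarrow> nat) \<Rightarrow> nat set \<Rightarrow> nat \<Rightarrow> nat" where
  "shrink \<mu> S i = \<mu> i - of_bool (i \<in> S)"

text \<open>
  A set of rows stands for the set of their last cells; it is a vertical strip when these cells exist and
  their removal leaves a partition.
\<close>
definition vertical_strips :: "nat \<Rightarrow> (nat \<Rightarrow> nat) \<Rightarrow> nat set set" where
  "vertical_strips a \<mu> = {S. S \<subseteq> {..<a} \<and> (\<forall>i\<in>S. \<mu> i > 0) \<and> descending a (shrink \<mu> S)}"

definition fill_strip :: "(nat \<Rightarrow> nat) \<Rightarrow> nat \<Rightarrow> nat set \<Rightarrow> (nat \<Rightarrow> nat \<Rightarrow> nat) \<Rightarrow> nat \<Rightarrow> nat \<Rightarrow> nat" where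
  "fill_strip \<mu> n S u i j = (if i \<in> S \<and> Suc j = \<mu> i then n else u i j)"

lemma finite_vertical_strips: "finite (vertical_strips a \<mu>)"
  by (rule finite_subset[of _ "Pow {..<a}"]) (auto simp: vertical_strips_def)

text \<open>
  If removing the last cells breaks the order between two neighbouring rows, the lengths of these rows
  were equal and now differ by one, so two rows of the matrix coincide. If the order is kept but some
  part drops to \<open>-1\<close>, then the last part is negative as well, and the last row of the matrix vanishes.
\<close>
lemma det_binomial_matrix_not_vertical_strip:
  assumes "descending a \<mu>" and "S \<subseteq> {..<a}" and "S \<notin> vertical_strips a \<mu>"
  shows "det (binomial_matrix a n (\<lambda>i. int (\<mu> i) - of_bool (i \<in> S))) = 0"
proof (cases "\<exists>i. Suc i < a \<and> int (\<mu> (Suc i)) - of_bool (Suc i \<in> S) > int (\<mu> i) - of_bool (i \<in> S)")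
  case True
  then obtain i where i: "Suc i < a"
    "int (\<mu> (Suc i)) - of_bool (Suc i \<in> S) > int (\<mu> i) - of_bool (i \<in> S)" by blast
  moreover have "\<mu> (Suc i) \<le> \<mu> i" using assms(1) i(1) by (simp add: descending_def)
  ultimately show ?thesis
    by (intro det_binomial_matrix_ascent[of i]) (auto simp: of_bool_def split: if_splits)
next
  case False
  define \<nu> where "\<nu> i = int (\<mu> i) - of_bool (i \<in> S)" for i
  have desc: "\<nu> (Suc i) \<le> \<nu> i" if "Suc i < a" for i using False that by (force simp: \<nu>_def)
  have "\<exists>i\<in>S. \<mu> i = 0"
  proof (rule ccontr)
    assume nz: "\<not> (\<exists>i\<in>S. \<mu> i = 0)"
    then have "int (shrink \<mu> S i) = \<nu> i" for i by (cases "i \<in> S") (auto simp: shrink_def \<nu>_def)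
    then have "descending a (shrink \<mu> S)" using desc unfolding descending_def
      by (metis of_nat_le_iff)
    then show False using assms nz by (auto simp: vertical_strips_def)
  qed
  then obtain i where i: "i < a" "\<nu> i = -1" using assms(2) by (auto simp: \<nu>_def)
  have "\<nu> (i + k) \<le> -1" if "i + k < a" for k
    using that
  proof (induction k)
    case (Suc k)
    then show ?case using desc[of "i + k"] by simp
  qed (use i in simp)
  \<comment> \<open>Column \<open>j\<close> of row \<open>a - 1\<close> has the lower index \<open>\<nu> (a - 1) - (a - 1) + j\<close>, at most \<open>-1\<close> for all \<open>j < a\<close>.\<close>
  from this[of "a - 1 - i"] have "\<nu> (a - 1) \<le> -1" using i by simp
  then have "det (binomial_matrix a n \<nu>) = 0"
    using i by (intro det_binomial_matrix_zero_row[of "a - 1"]) (auto simp: zbinom_def)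
  then show ?thesis unfolding \<nu>_def[abs_def] .
qed

lemma tableaux_row_strict:
  assumes "u \<in> tableaux a \<mu> n" and "i < a" and "j < j'" and "j' < \<mu> i"
  shows "u i j < u i j'"
  using assms(3,4)
proof (induction j')
  case (Suc j')
  have "u i j' < u i (Suc j')" using assms(1,2) Suc.prems by (auto simp: tableaux_def)
  with Suc show ?case by (cases "j = j'") auto
qed simp

lemma fill_strip_in_tableaux:
  assumes "descending a \<mu>" "S \<in> vertical_strips a \<mu>" "u \<in> tableaux a (shrink \<mu> S) n"
  shows "fill_strip \<mu> n S u \<in> tableaux a \<mu> (Suc n)"
proof -
  have S: "S \<subseteq> {..<a}" "\<And>i. i \<in> S \<Longrightarrow> \<mu> i > 0"
    and dS: "\<And>i. Suc i < a \<Longrightarrow> shrink \<mu> S (Suc i) \<le> shrink \<mu> S i"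
    using assms(2) by (auto simp: vertical_strips_def descending_def)
  have d: "\<And>i. Suc i < a \<Longrightarrow> \<mu> (Suc i) \<le> \<mu> i" using assms(1) by (simp add: descending_def)
  have u0: "\<And>i j. \<not> (i < a \<and> j < shrink \<mu> S i) \<Longrightarrow> u i j = 0"
    and un: "\<And>i j. i < a \<Longrightarrow> j < shrink \<mu> S i \<Longrightarrow> u i j < n"
    and ur: "\<And>i j. i < a \<Longrightarrow> Suc j < shrink \<mu> S i \<Longrightarrow> u i j < u i (Suc j)"
    and uc: "\<And>i j. Suc i < a \<Longrightarrow> j < shrink \<mu> S i \<Longrightarrow> j < shrink \<mu> S (Suc i) \<Longrightarrow> u i j \<le> u (Suc i) j"
    using assms(3) by (auto simp: tableaux_def)
  have new: "j < shrink \<mu> S i \<longleftrightarrow> j < \<mu> i \<and> \<not> (i \<in> S \<and> Suc j = \<mu> i)" for i j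
    using S(2)[of i] by (auto simp: shrink_def)
  show ?thesis unfolding tableaux_def mem_Collect_eq
  proof (intro conjI allI impI)
    fix i j assume "\<not> (i < a \<and> j < \<mu> i)"
    then show "fill_strip \<mu> n S u i j = 0"
      using u0[of i j] S(1) by (auto simp: fill_strip_def new)
  next
    fix i j assume "i < a" "j < \<mu> i"
    then show "fill_strip \<mu> n S u i j < Suc n"
      using un[of i j] by (auto simp: fill_strip_def new)
  next
    fix i j assume "i < a" "Suc j < \<mu> i"
    then show "fill_strip \<mu> n S u i j < fill_strip \<mu> n S u i (Suc j)"
      using un[of i j] ur[of i j] by (auto simp: fill_strip_def new)
  next
    fix i j assume ij: "Suc i < a" "j < \<mu> i" "j < \<mu> (Suc i)"
    show "fill_strip \<mu> n S u i j \<le> fill_strip \<mu> n S u (Suc i) j"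
    proof (cases "Suc i \<in> S \<and> Suc j = \<mu> (Suc i)")
      case True
      then show ?thesis using un[of i j] ij by (auto simp: fill_strip_def new)
    next
      case False
      then have j: "j < shrink \<mu> S (Suc i)" using ij by (simp add: new)
      then have "j < shrink \<mu> S i" using dS[of i] ij by simp
      then show ?thesis using uc[of i j] ij j by (auto simp: fill_strip_def new)
    qed
  qed
qed

text \<open>
  Rows are strict, so the largest entry \<open>n\<close> occurs in a row at most once, and then at its end.
  Columns are weak, so below a cell with entry \<open>n\<close> there are only cells with entry \<open>n\<close>; hence the cells
  with entry \<open>n\<close> form a vertical strip, and removing them leaves a tableau with entries below \<open>n\<close>.
\<close>
lemma tableaux_Suc:
  assumes "descending a \<mu>"
  shows "tableaux a \<mu> (Suc n) =
     (\<Union>S\<in>vertical_strips a \<mu>. fill_strip \<mu> n S ` tableaux a (shrink \<mu> S) n)"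
proof (intro equalityI subsetI)
  fix u assume u: "u \<in> tableaux a \<mu> (Suc n)"
  define S where "S = {i. i < a \<and> \<mu> i > 0 \<and> u i (\<mu> i - 1) = n}"
  define v where "v i j = (if j < shrink \<mu> S i then u i j else 0)" for i j
  have d: "\<And>i. Suc i < a \<Longrightarrow> \<mu> (Suc i) \<le> \<mu> i" using assms by (simp add: descending_def)
  have u0: "\<And>i j. \<not> (i < a \<and> j < \<mu> i) \<Longrightarrow> u i j = 0"
    and un: "\<And>i j. i < a \<Longrightarrow> j < \<mu> i \<Longrightarrow> u i j < Suc n"
    and ur: "\<And>i j. i < a \<Longrightarrow> Suc j < \<mu> i \<Longrightarrow> u i j < u i (Suc j)"
    and uc: "\<And>i j. Suc i < a \<Longrightarrow> j < \<mu> i \<Longrightarrow> j < \<mu> (Suc i) \<Longrightarrow> u i j \<le> u (Suc i) j"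
    using u by (auto simp: tableaux_def)
  have new: "j < shrink \<mu> S i \<longleftrightarrow> j < \<mu> i \<and> \<not> (i \<in> S \<and> Suc j = \<mu> i)" for i j
    by (auto simp: shrink_def S_def)
  have small: "u i j < n" if "i < a" "j < shrink \<mu> S i" for i j
  proof (cases "Suc j = \<mu> i")
    case True
    then have "i \<notin> S" "j = \<mu> i - 1" using that by (auto simp: new)
    then show ?thesis using that un[of i j] True by (auto simp: S_def)
  next
    case False
    then have "Suc j < \<mu> i" using that by (auto simp: new)
    then show ?thesis using ur[of i j] un[of i "Suc j"] that by simp
  qed
  have strip: "S \<in> vertical_strips a \<mu>" unfolding vertical_strips_def descending_def mem_Collect_eq
  proof (intro conjI allI impI)
    fix i assume i: "Suc i < a"
    show "shrink \<mu> S (Suc i) \<le> shrink \<mu> S i"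
    proof (cases "i \<in> S \<and> \<mu> (Suc i) = \<mu> i")
      case True
      then have "u i (\<mu> i - 1) = n" "\<mu> i > 0" by (auto simp: S_def)
      with True i have "Suc i \<in> S"
        using uc[of i "\<mu> i - 1"] un[of "Suc i" "\<mu> i - 1"] by (auto simp: S_def)
      then show ?thesis using True by (simp add: shrink_def)
    next
      case False
      then show ?thesis using d[OF i] by (auto simp: shrink_def)
    qed
  qed (auto simp: S_def)
  have "v \<in> tableaux a (shrink \<mu> S) n" unfolding tableaux_def mem_Collect_eq
  proof (intro conjI allI impI)
    fix i j assume "\<not> (i < a \<and> j < shrink \<mu> S i)"
    then show "v i j = 0" using u0[of i j] by (auto simp: v_def)
  next
    fix i j assume "i < a" "j < shrink \<mu> S i"
    then show "v i j < n" using small by (simp add: v_def)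
  next
    fix i j assume "i < a" "Suc j < shrink \<mu> S i"
    then show "v i j < v i (Suc j)" using ur[of i j] by (auto simp: v_def new)
  next
    fix i j assume "Suc i < a" "j < shrink \<mu> S i" "j < shrink \<mu> S (Suc i)"
    then show "v i j \<le> v (Suc i) j" using uc[of i j] by (auto simp: v_def new)
  qed
  moreover have "u = fill_strip \<mu> n S v"
  proof (intro ext)
    fix i j show "u i j = fill_strip \<mu> n S v i j"
    proof (cases "i \<in> S \<and> Suc j = \<mu> i")
      case True
      then have "j = \<mu> i - 1" by linarith
      then show ?thesis using True by (auto simp: fill_strip_def S_def)
    next
      case False
      then show ?thesis using u0[of i j] by (auto simp: fill_strip_def v_def new)
    qed
  qed
  ultimately show "u \<in> (\<Union>S\<in>vertical_strips a \<mu>. fill_strip \<mu> n S ` tableaux a (shrink \<mu> S) n)"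
    using strip by blast
next
  fix u assume "u \<in> (\<Union>S\<in>vertical_strips a \<mu>. fill_strip \<mu> n S ` tableaux a (shrink \<mu> S) n)"
  then show "u \<in> tableaux a \<mu> (Suc n)" using fill_strip_in_tableaux[OF assms] by blast
qed

text \<open>
  The strip can be read off the filled tableau: it consists of the cells with entry \<open>n\<close>.
\<close>
lemma fill_strip_inject:
  assumes "S \<in> vertical_strips a \<mu>" "T \<in> vertical_strips a \<mu>"
    and "u \<in> tableaux a (shrink \<mu> S) n" "v \<in> tableaux a (shrink \<mu> T) n"
    and eq: "fill_strip \<mu> n S u = fill_strip \<mu> n T v"
  shows "S = T \<and> u = v"
proof -
  have sub: "S \<subseteq> T" if S: "S \<in> vertical_strips a \<mu>" and T: "T \<in> vertical_strips a \<mu>"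
    and v: "v \<in> tableaux a (shrink \<mu> T) n"
    and eq: "fill_strip \<mu> n S u = fill_strip \<mu> n T v" for S T u v
  proof
    fix i assume i: "i \<in> S"
    then have ia: "i < a" "\<mu> i > 0" using S by (auto simp: vertical_strips_def)
    show "i \<in> T"
    proof (rule ccontr)
      assume "i \<notin> T"
      then have "v i (\<mu> i - 1) < n" using v ia by (auto simp: tableaux_def shrink_def)
      moreover have "v i (\<mu> i - 1) = n"
        using fun_cong[OF fun_cong[OF eq, of i], of "\<mu> i - 1"] i ia \<open>i \<notin> T\<close>
        by (simp add: fill_strip_def)
      ultimately show False by simp
    qed
  qed
  have ST: "S = T" using sub[of S T v u] sub[of T S u v] assms by auto
  have "u i j = v i j" for i j
  proof (cases "i \<in> S \<and> Suc j = \<mu> i")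
    case True
    then have "\<not> j < shrink \<mu> S i" by (auto simp: shrink_def)
    then show ?thesis using assms ST by (auto simp: tableaux_def)
  next
    case False
    then show ?thesis using fun_cong[OF fun_cong[OF eq, of i], of j] ST
      by (auto simp: fill_strip_def split: if_splits)
  qed
  then show ?thesis using ST by blast
qed

lemma tableaux_0: "tableaux a \<mu> 0 = (if \<forall>i<a. \<mu> i = 0 then {\<lambda>_ _. 0} else {})"
proof (cases "\<forall>i<a. \<mu> i = 0")
  case True
  then have "u \<in> tableaux a \<mu> 0 \<longleftrightarrow> (\<forall>i j. u i j = 0)" for u
    by (auto simp: tableaux_def)
  then show ?thesis using True by (auto simp: fun_eq_iff)
next
  case False
  then have "u \<notin> tableaux a \<mu> 0" for u unfolding tableaux_def by blast
  then show ?thesis using False by auto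
qed

lemma finite_tableaux:
  "descending a \<mu> \<Longrightarrow> finite (tableaux a \<mu> n)"
proof (induction n arbitrary: \<mu>)
  case (Suc n)
  show ?case unfolding tableaux_Suc[OF Suc.prems]
    using Suc.IH by (intro finite_UN_I finite_vertical_strips finite_imageI) (auto simp: vertical_strips_def)
qed (simp add: tableaux_0)

text \<open>
  Induction on \<open>n\<close>: removing the largest entries matches the expansion of the determinant, apart from
  summands that vanish. For \<open>n = 0\<close> only the empty shape has a tableau; its matrix is the identity, while
  the first row is zero for any other shape.
\<close>
theorem card_tableaux:
  assumes "descending a \<mu>"
  shows "int (card (tableaux a \<mu> n)) = det (binomial_matrix a n (\<lambda>i. int (\<mu> i)))"
  using assms
proof (induction n arbitrary: \<mu>)
  case 0
  show ?case
  proof (cases "\<forall>i<a. \<mu> i = 0")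
    case True
    then have "binomial_matrix a 0 (\<lambda>i. int (\<mu> i)) = 1\<^sub>m a"
      by (intro eq_matI) (auto simp: binomial_matrix_def zbinom_0)
    then show ?thesis using True by (simp add: tableaux_0)
  next
    case False
    then obtain i where i: "i < a" "\<mu> i > 0" by auto
    have "\<mu> i \<le> \<mu> 0" using i(1)
    proof (induction i)
      case (Suc i)
      then show ?case using 0 by (auto simp: descending_def intro: order_trans)
    qed simp
    then have "det (binomial_matrix a 0 (\<lambda>i. int (\<mu> i))) = 0"
      using i by (intro det_binomial_matrix_zero_row[of 0]) (auto simp: zbinom_0)
    then show ?thesis using False by (auto simp: tableaux_0)
  qed
next
  case (Suc n)
  let ?V = "vertical_strips a \<mu>"
  let ?T = "\<lambda>S. tableaux a (shrink \<mu> S) n"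
  have desc: "descending a (shrink \<mu> S)" if "S \<in> ?V" for S
    using that by (simp add: vertical_strips_def)
  have "card (tableaux a \<mu> (Suc n)) = (\<Sum>S\<in>?V. card (fill_strip \<mu> n S ` ?T S))"
    unfolding tableaux_Suc[OF Suc.prems]
  proof (rule card_UN_disjoint)
    show "\<forall>S\<in>?V. \<forall>T\<in>?V. S \<noteq> T \<longrightarrow> fill_strip \<mu> n S ` ?T S \<inter> fill_strip \<mu> n T ` ?T T = {}"
      using fill_strip_inject by fastforce
  qed (use desc finite_tableaux finite_vertical_strips in auto)
  also have "\<dots> = (\<Sum>S\<in>?V. card (?T S))"
  proof (rule sum.cong)
    fix S assume "S \<in> ?V"
    then show "card (fill_strip \<mu> n S ` ?T S) = card (?T S)"
      using fill_strip_inject by (intro card_image inj_onI) blast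
  qed simp
  finally have "int (card (tableaux a \<mu> (Suc n))) = (\<Sum>S\<in>?V. int (card (?T S)))" by simp
  also have "\<dots> = (\<Sum>S\<in>?V. det (binomial_matrix a n (\<lambda>i. int (\<mu> i) - of_bool (i \<in> S))))"
  proof (rule sum.cong)
    fix S assume S: "S \<in> ?V"
    then have "(\<lambda>i. int (shrink \<mu> S i)) = (\<lambda>i. int (\<mu> i) - of_bool (i \<in> S))"
      by (intro ext) (auto simp: shrink_def vertical_strips_def of_nat_diff Suc_leI)
    then show "int (card (?T S)) = det (binomial_matrix a n (\<lambda>i. int (\<mu> i) - of_bool (i \<in> S)))"
      using Suc.IH[OF desc[OF S]] by simp
  qed simp
  also have "\<dots> = (\<Sum>S\<in>Pow {..<a}. det (binomial_matrix a n (\<lambda>i. int (\<mu> i) - of_bool (i \<in> S))))"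
    using det_binomial_matrix_not_vertical_strip[OF Suc.prems]
    by (intro sum.mono_neutral_left) (auto simp: vertical_strips_def)
  also have "\<dots> = det (binomial_matrix a (Suc n) (\<lambda>i. int (\<mu> i)))"
    by (simp add: det_binomial_matrix_Suc)
  finally show ?case .
qed

section \<open>Plane partitions as tableaux of rectangular shape\<close>

text \<open>
  Row \<open>i\<close> of a plane partition is a partition in a \<open>b \<times> c\<close> rectangle, whose boundary is a lattice path of
  \<open>b + c\<close> steps. The tableau lists in row \<open>i\<close> the positions of the \<open>b\<close> horizontal steps. These positions
  are strictly increasing, and containment of consecutive rows of the plane partition becomes weak
  increase down the columns.
\<close>
lemma bij_betw_plane_partitions_tableaux:
  "bij_betw (\<lambda>\<pi> i j. if i < a \<and> j < b then c - \<pi> i j + j else 0)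
     (plane_partitions_in_box a b c) (tableaux a (\<lambda>_. b) (b + c))"
proof (rule bij_betw_byWitness[where f' = "\<lambda>u i j. if i < a \<and> j < b then c + j - u i j else 0"])
  let ?f = "\<lambda>\<pi> i j. if i < a \<and> j < b then c - \<pi> i j + j else (0::nat)"
  let ?g = "\<lambda>u i j. if i < a \<and> j < b then c + j - u i j else (0::nat)"
  have pp: "\<pi> i j \<le> c" "\<not> (i < a \<and> j < b) \<Longrightarrow> \<pi> i j = 0"
    "\<pi> i (Suc j) \<le> \<pi> i j" "\<pi> (Suc i) j \<le> \<pi> i j"
    if "\<pi> \<in> plane_partitions_in_box a b c" for \<pi> i j
  proof -
    have "plane_partition \<pi>" and box: "in_box a b c \<pi>"
      using that by (auto simp: plane_partitions_in_box_def)
    then show "\<pi> i (Suc j) \<le> \<pi> i j" "\<pi> (Suc i) j \<le> \<pi> i j"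
      unfolding plane_partition_def by blast+
    have "\<pi> i j > 0 \<longrightarrow> i < a \<and> j < b \<and> \<pi> i j \<le> c" using box unfolding in_box_def by blast
    then show "\<pi> i j \<le> c" "\<not> (i < a \<and> j < b) \<Longrightarrow> \<pi> i j = 0" by auto
  qed
  \<comment> \<open>Strictness confines the entries of a row: at least \<open>j\<close> numbers precede \<open>u i j\<close>, and at least
    \<open>b - 1 - j\<close> numbers below \<open>b + c\<close> follow it. So the inverse map has values at most \<open>c\<close>,
    and its subtraction is never truncated.\<close>
  have lower: "j \<le> u i j" if u: "u \<in> tableaux a (\<lambda>_. b) (b + c)" and "i < a" "j < b" for u i j
    using that(3)
  proof (induction j)
    case (Suc j)
    have "u i j < u i (Suc j)" using tableaux_row_strict[OF u \<open>i < a\<close>, of j "Suc j"] Suc by simp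
    then show ?case using Suc by simp
  qed simp
  have upper: "u i j \<le> c + j" if u: "u \<in> tableaux a (\<lambda>_. b) (b + c)" and "i < a" "j < b" for u i j
  proof -
    have "k < b \<Longrightarrow> u i (b - Suc k) \<le> c + (b - Suc k)" for k
    proof (induction k)
      case 0
      have "u i (b - 1) < b + c" using u \<open>i < a\<close> 0 unfolding tableaux_def by simp
      then show ?case using 0 by simp
    next
      case (Suc k)
      then show ?case
        using tableaux_row_strict[OF u \<open>i < a\<close>, of "b - Suc (Suc k)" "b - Suc k"] by linarith
    qed
    from this[of "b - Suc j"] show ?thesis using that(3) by simp
  qed
  show "\<forall>\<pi>\<in>plane_partitions_in_box a b c. ?g (?f \<pi>) = \<pi>"
  proof
    fix \<pi> assume \<pi>: "\<pi> \<in> plane_partitions_in_box a b c"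
    show "?g (?f \<pi>) = \<pi>"
    proof (intro ext)
      fix i j show "?g (?f \<pi>) i j = \<pi> i j"
        using pp(1,2)[OF \<pi>, of i j] by auto
    qed
  qed
  show "\<forall>u\<in>tableaux a (\<lambda>_. b) (b + c). ?f (?g u) = u"
  proof
    fix u assume u: "u \<in> tableaux a (\<lambda>_. b) (b + c)"
    show "?f (?g u) = u"
    proof (intro ext)
      fix i j
      have "\<not> (i < a \<and> j < b) \<Longrightarrow> u i j = 0" using u unfolding tableaux_def by blast
      then show "?f (?g u) i j = u i j"
        using lower[OF u, of i j] upper[OF u, of i j] by auto
    qed
  qed
  show "?f ` plane_partitions_in_box a b c \<subseteq> tableaux a (\<lambda>_. b) (b + c)"
  proof safe
    fix \<pi> assume \<pi>: "\<pi> \<in> plane_partitions_in_box a b c"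
    show "?f \<pi> \<in> tableaux a (\<lambda>_. b) (b + c)" unfolding tableaux_def mem_Collect_eq
    proof (intro conjI allI impI)
      fix i j assume "i < a" "Suc j < b"
      then show "?f \<pi> i j < ?f \<pi> i (Suc j)" using pp(3)[OF \<pi>, of i j] by simp
    next
      fix i j assume "Suc i < a" "j < b" 
      then show "?f \<pi> i j \<le> ?f \<pi> (Suc i) j" using pp(4)[OF \<pi>, of i j] by simp
    qed auto
  qed
  show "?g ` tableaux a (\<lambda>_. b) (b + c) \<subseteq> plane_partitions_in_box a b c"
  proof safe
    fix u assume u: "u \<in> tableaux a (\<lambda>_. b) (b + c)"
    have "finite {(i, j). ?g u i j > 0}"
      by (rule finite_subset[of _ "{..<a} \<times> {..<b}"]) (auto split: if_splits)
    moreover have "?g u i (Suc j) \<le> ?g u i j" for i j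
    proof (cases "i < a \<and> Suc j < b")
      case True
      then have "u i j < u i (Suc j)" using tableaux_row_strict[OF u] by simp
      then show ?thesis using True by simp
    qed auto
    moreover have "?g u (Suc i) j \<le> ?g u i j" for i j
    proof (cases "Suc i < a \<and> j < b")
      case True
      then have "u i j \<le> u (Suc i) j" using u unfolding tableaux_def by blast
      then show ?thesis using True by simp
    qed auto
    moreover have "?g u i j > 0 \<longrightarrow> i < a \<and> j < b \<and> ?g u i j \<le> c" for i j
      using lower[OF u, of i j] by auto
    ultimately show "?g u \<in> plane_partitions_in_box a b c"
      unfolding plane_partitions_in_box_def plane_partition_def in_box_def mem_Collect_eq
      by blast
  qed
qed

theorem card_plane_partitions_in_box:
  "int (card (plane_partitions_in_box a b c)) = det (binomial_matrix a (b + c) (\<lambda>_. int b))"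
  using card_tableaux[of a "\<lambda>_. b" "b + c"] bij_betw_same_card[OF bij_betw_plane_partitions_tableaux]
  by (simp add: descending_def)

section \<open>Polynomials and monomial ideals\<close>

abbreviation "lookup \<equiv> Poly_Mapping.lookup"
abbreviation "keys \<equiv> Poly_Mapping.keys"

lemma lookup_monomial_times:
  fixes m k :: "'v \<Rightarrow>\<^sub>0 nat"
  shows "lookup (Poly_Mapping.single m c * f) (m + k) = c * lookup f k"
  by (simp add: lookup_mult lookup_single when_mult)

lemma lookup_monomial_times_not_multiple:
  assumes "\<And>k. m' \<noteq> m + k"
  shows "lookup (Poly_Mapping.single m c * f) m' = 0"
  using assms by (simp add: lookup_mult lookup_single when_mult)

lemma sum_monomials: "(\<Sum>m\<in>keys f. Poly_Mapping.single m (lookup f m)) = f"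
proof (rule poly_mapping_eqI)
  fix k
  have "lookup (\<Sum>m\<in>keys f. Poly_Mapping.single m (lookup f m)) k =
        (\<Sum>m\<in>keys f. if m = k then lookup f m else 0)"
    by (simp add: lookup_sum lookup_single when_def)
  also have "\<dots> = lookup f k" by (simp add: in_keys_iff)
  finally show "lookup (\<Sum>m\<in>keys f. Poly_Mapping.single m (lookup f m)) k = lookup f k" .
qed

lemma monomial_degree_add: "monomial_degree (m + m') = monomial_degree m + monomial_degree m'"
  unfolding monomial_degree_def by (rule setsum_keys_plus_distrib) simp_all

lemma monomial_degree_single [simp]: "monomial_degree (Poly_Mapping.single v d) = d"
  by (simp add: monomial_degree_def)

lemma homogeneous_lookup_eq_0:
  "homogeneous d f \<Longrightarrow> monomial_degree m \<noteq> d \<Longrightarrow> lookup f m = 0"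
  unfolding homogeneous_def in_keys_iff[symmetric] by (metis in_keys_iff)

lemma homogeneous_0: "homogeneous d 0"
  by (simp add: homogeneous_def)

lemma homogeneous_single: "monomial_degree m = d \<Longrightarrow> homogeneous d (Poly_Mapping.single m c)"
  by (simp add: homogeneous_def)

lemma homogeneous_add: "homogeneous d f \<Longrightarrow> homogeneous d g \<Longrightarrow> homogeneous d (f + g)"
  using Poly_Mapping.keys_add[of f g] unfolding homogeneous_def by blast

lemma homogeneous_diff:
  fixes f g :: "('v, 'k::comm_ring_1) multipoly"
  shows "homogeneous d f \<Longrightarrow> homogeneous d g \<Longrightarrow> homogeneous d (f - g)"
  using keys_diff[of f g] unfolding homogeneous_def by blast

lemma homogeneous_mult: "homogeneous d f \<Longrightarrow> homogeneous d' g \<Longrightarrow> homogeneous (d + d') (f * g)"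
  unfolding homogeneous_def
proof
  fix m assume *: "\<forall>m\<in>keys f. monomial_degree m = d" "\<forall>m\<in>keys g. monomial_degree m = d'"
    and "m \<in> keys (f * g)"
  then obtain k l where "m = k + l" "k \<in> keys f" "l \<in> keys g" using keys_mult[of f g] by blast
  then show "monomial_degree m = d + d'" using * by (simp add: monomial_degree_add)
qed

lemma homogeneous_indet: "homogeneous 1 (indet v)"
  by (simp add: indet_def homogeneous_single)

lemma homogeneous_indet_mult: "homogeneous d f \<Longrightarrow> homogeneous (Suc d) (indet v * f)"
  using homogeneous_mult[OF homogeneous_indet] by simp

lemma indet_power: "indet v ^ d = Poly_Mapping.single (Poly_Mapping.single v d) 1"
  by (induction d) (simp_all add: indet_def mult_single single_add[symmetric])

text \<open>
  The ideal generated by the powers \<open>v ^ e v\<close> of the variables, described by the monomials that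
  occur in its elements.
\<close>
definition power_ideal :: "('v \<Rightarrow> nat) \<Rightarrow> ('v, 'k::comm_ring_1) multipoly set" where
  "power_ideal e = {f. \<forall>m\<in>keys f. \<exists>v. e v \<le> lookup m v}"

lemma power_ideal_0: "0 \<in> power_ideal e"
  by (simp add: power_ideal_def)

lemma power_ideal_add: "f \<in> power_ideal e \<Longrightarrow> g \<in> power_ideal e \<Longrightarrow> f + g \<in> power_ideal e"
  using Poly_Mapping.keys_add[of f g] unfolding power_ideal_def by blast

lemma power_ideal_mult: "f \<in> power_ideal e \<Longrightarrow> g * f \<in> power_ideal e"
  unfolding power_ideal_def mem_Collect_eq
proof
  fix m assume f: "\<forall>m\<in>keys f. \<exists>v. e v \<le> lookup m v" and "m \<in> keys (g * f)"
  then obtain k l where "m = k + l" "l \<in> keys f" using keys_mult[of g f] by blast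
  then show "\<exists>v. e v \<le> lookup m v" using f by (auto simp: lookup_add intro: trans_le_add2)
qed

lemma power_ideal_uminus: "f \<in> power_ideal e \<Longrightarrow> - f \<in> power_ideal e"
  using power_ideal_mult[of f e "-1"] by simp

lemma power_ideal_iff:
  "f \<in> power_ideal e \<longleftrightarrow> (\<forall>m. (\<forall>v. lookup m v < e v) \<longrightarrow> lookup f m = 0)"
  unfolding power_ideal_def mem_Collect_eq Ball_def in_keys_iff by (meson not_le)

lemma type_ring_simps [simp]:
  "carrier (ring_of_type_algebra :: 'a::comm_ring_1 ring) = UNIV"
  "x \<otimes>\<^bsub>ring_of_type_algebra\<^esub> y = x * (y :: 'a)"
  "x \<oplus>\<^bsub>ring_of_type_algebra\<^esub> y = x + (y :: 'a)"
  "\<zero>\<^bsub>ring_of_type_algebra\<^esub> = (0 :: 'a)"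
  by (simp_all add: ring_of_type_algebra_def)

lemma type_ring_minus [simp]: "x \<ominus>\<^bsub>ring_of_type_algebra\<^esub> y = x - (y :: 'a::comm_ring_1)"
proof -
  interpret ring "ring_of_type_algebra :: 'a ring" by (rule ring_from_type_algebra)
  have "\<ominus>\<^bsub>ring_of_type_algebra\<^esub> y = - y" by (rule minus_equality) simp_all
  then show ?thesis by (simp add: a_minus_def)
qed

lemma ideal_power_ideal:
  "ideal (power_ideal e :: ('v, 'k::comm_ring_1) multipoly set) ring_of_type_algebra"
proof (rule idealI)
  let ?R = "ring_of_type_algebra :: ('v, 'k) multipoly ring"
  interpret ring ?R by (rule ring_from_type_algebra)
  show "ring ?R" ..
  show "subgroup (power_ideal e) (add_monoid ?R)"
  proof (rule add.subgroupI)
    fix f :: "('v, 'k) multipoly"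
    have "\<ominus>\<^bsub>?R\<^esub> f = - f" by (rule minus_equality) simp_all
    then show "f \<in> power_ideal e \<Longrightarrow> \<ominus>\<^bsub>?R\<^esub> f \<in> power_ideal e"
      by (simp add: power_ideal_uminus)
  qed (use power_ideal_0 in \<open>auto simp: power_ideal_add\<close>)
qed (use power_ideal_mult in \<open>auto simp: mult.commute\<close>)

text \<open>
  Each monomial of an element of \<open>power_ideal e\<close> is a multiple of one of the generators, and
  the element is a finite sum of such monomials.
\<close>
lemma genideal_pure_powers:
  "genideal ring_of_type_algebra (range (\<lambda>v. indet v ^ e v)) =
     (power_ideal e :: ('v, 'k::comm_ring_1) multipoly set)"
proof
  let ?R = "ring_of_type_algebra :: ('v, 'k) multipoly ring"
  let ?J = "genideal ?R (range (\<lambda>v. indet v ^ e v))"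
  interpret ring ?R by (rule ring_from_type_algebra)
  show "?J \<subseteq> power_ideal e"
    by (rule genideal_minimal[OF ideal_power_ideal])
       (auto simp: power_ideal_def indet_power lookup_single when_def split: if_splits)
  interpret J: ideal ?J ?R by (rule genideal_ideal) simp
  have gen: "indet v ^ e v \<in> ?J" for v
    using genideal_self[of "range (\<lambda>v. indet v ^ e v)"] by auto
  show "power_ideal e \<subseteq> ?J"
  proof
    fix f :: "('v, 'k) multipoly" assume f: "f \<in> power_ideal e"
    have monomial: "Poly_Mapping.single m c \<in> ?J" if "m \<in> keys f" for m c
    proof -
      obtain v where v: "e v \<le> lookup m v" using f \<open>m \<in> keys f\<close> by (auto simp: power_ideal_def)
      then have "Poly_Mapping.single v (e v) + (m - Poly_Mapping.single v (e v)) = m"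
        by (intro poly_mapping_eqI) (auto simp: lookup_add lookup_minus lookup_single when_def)
      then have "Poly_Mapping.single m c =
          Poly_Mapping.single (m - Poly_Mapping.single v (e v)) c * indet v ^ e v"
        by (simp add: indet_power mult_single add.commute)
      then show ?thesis using J.I_l_closed[OF gen] by simp
    qed
    have "(\<Sum>m\<in>A. Poly_Mapping.single m (lookup f m)) \<in> ?J" if "finite A" "A \<subseteq> keys f" for A
      using that
    proof (induction A rule: finite_induct)
      case empty
      then show ?case using J.zero_closed by simp
    next
      case (insert m A)
      then show ?case using J.a_closed[of "Poly_Mapping.single m (lookup f m)"] monomial by simp
    qed
    from this[of "keys f"] show "f \<in> ?J" by (simp add: sum_monomials)
  qed
qed

section \<open>Reduction of the Weak Lefschetz Property to the middle degree\<close>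

text \<open>
  Maximal rank is stated for polynomials that represent the elements of the quotient modulo \<open>I\<close>, so
  that the arguments below take place in the polynomial ring.
\<close>
definition multiplication_injective ::
  "('v, 'k::comm_ring_1) multipoly set \<Rightarrow> ('v, 'k) multipoly \<Rightarrow> nat \<Rightarrow> bool" where
  "multiplication_injective I L i \<longleftrightarrow> (\<forall>f. homogeneous i f \<longrightarrow> L * f \<in> I \<longrightarrow> f \<in> I)"

definition multiplication_surjective ::
  "('v, 'k::comm_ring_1) multipoly set \<Rightarrow> ('v, 'k) multipoly \<Rightarrow> nat \<Rightarrow> bool" where
  "multiplication_surjective I L i \<longleftrightarrow>
     (\<forall>g. homogeneous (Suc i) g \<longrightarrow> (\<exists>f. homogeneous i f \<and> g - L * f \<in> I))"

lemma weak_lefschetz_quotient_algebra: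
  fixes S :: "('v, 'k::comm_ring_1) multipoly set"
  defines "I \<equiv> genideal ring_of_type_algebra S"
  shows "weak_lefschetz (quotient_algebra S) (graded_component S) \<longleftrightarrow>
    (\<exists>L. homogeneous 1 L \<and>
       (\<forall>i. multiplication_injective I L i \<or> multiplication_surjective I L i))"
proof -
  let ?R = "ring_of_type_algebra :: ('v, 'k) multipoly ring"
  interpret ring ?R by (rule ring_from_type_algebra)
  interpret I: ideal I ?R unfolding I_def by (rule genideal_ideal) simp
  define cos where "cos f = I +>\<^bsub>?R\<^esub> f" for f
  have cos_eq: "cos f = cos g \<longleftrightarrow> f - g \<in> I" for f g
    using quotient_eq_iff_same_a_r_cos[OF I.ideal_axioms, of f g] by (simp add: cos_def)
  have gr: "graded_component S d = cos ` {f. homogeneous d f}" for d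
    by (auto simp: graded_component_def cos_def I_def)
  have mult: "cos f \<otimes>\<^bsub>quotient_algebra S\<^esub> cos g = cos (f * g)" for f g
    using I.rcoset_mult_add[of f g] by (simp add: quotient_algebra_def FactRing_def cos_def flip: I_def)
  have "inj_on (\<lambda>u. cos L \<otimes>\<^bsub>quotient_algebra S\<^esub> u) (graded_component S i) \<longleftrightarrow>
      multiplication_injective I L i" (is "?inj \<longleftrightarrow> _") for L i
  proof
    assume inj: ?inj
    show "multiplication_injective I L i" unfolding multiplication_injective_def
    proof (intro allI impI)
      fix f :: "('v, 'k) multipoly" assume f: "homogeneous i f" "L * f \<in> I"
      then have "cos L \<otimes>\<^bsub>quotient_algebra S\<^esub> cos f = cos L \<otimes>\<^bsub>quotient_algebra S\<^esub> cos 0"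
        by (simp only: mult cos_eq mult_zero_right diff_zero)
      then have "cos f = cos 0"
        by (rule inj_onD[OF inj]) (simp_all add: gr f(1) homogeneous_0)
      then show "f \<in> I" by (simp add: cos_eq)
    qed
  next
    assume inj: "multiplication_injective I L i"
    show ?inj
    proof (rule inj_onI)
      fix u v assume "u \<in> graded_component S i" "v \<in> graded_component S i"
      then obtain f g where fg: "u = cos f" "v = cos g" "homogeneous i f" "homogeneous i g"
        unfolding gr by blast
      assume "cos L \<otimes>\<^bsub>quotient_algebra S\<^esub> u = cos L \<otimes>\<^bsub>quotient_algebra S\<^esub> v"
      then have "L * (f - g) \<in> I" by (simp only: fg mult cos_eq right_diff_distrib)
      then show "u = v"
        using inj homogeneous_diff[OF fg(3,4)] by (simp add: fg cos_eq multiplication_injective_def)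
    qed
  qed
  moreover have "(\<lambda>u. cos L \<otimes>\<^bsub>quotient_algebra S\<^esub> u) ` graded_component S i = graded_component S (Suc i)
      \<longleftrightarrow> multiplication_surjective I L i" (is "?im = _ \<longleftrightarrow> _") if "homogeneous 1 L" for L i
  proof -
    have im: "?im = (\<lambda>f. cos (L * f)) ` {f. homogeneous i f}"
      by (simp add: gr image_image mult)
    have "cos (L * f) \<in> graded_component S (Suc i)" if "homogeneous i f" for f
      using homogeneous_mult[OF \<open>homogeneous 1 L\<close> that] unfolding gr by simp
    then have "?im \<subseteq> graded_component S (Suc i)" unfolding im by blast
    then have "?im = graded_component S (Suc i) \<longleftrightarrow> cos ` {g. homogeneous (Suc i) g} \<subseteq> ?im"
      unfolding gr by blast
    also have "\<dots> \<longleftrightarrow> (\<forall>g. homogeneous (Suc i) g \<longrightarrow> (\<exists>f. homogeneous i f \<and> cos g = cos (L * f)))"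
      unfolding im by blast
    finally show ?thesis by (simp only: multiplication_surjective_def cos_eq)
  qed
  ultimately have lefschetz_element: "(\<forall>i. inj_on (\<lambda>u. cos L \<otimes>\<^bsub>quotient_algebra S\<^esub> u) (graded_component S i) \<or>
        (\<lambda>u. cos L \<otimes>\<^bsub>quotient_algebra S\<^esub> u) ` graded_component S i = graded_component S (Suc i)) \<longleftrightarrow>
      (\<forall>i. multiplication_injective I L i \<or> multiplication_surjective I L i)"
    if "homogeneous 1 L" for L
    using that by (simp only:)
  have "weak_lefschetz (quotient_algebra S) (graded_component S) \<longleftrightarrow> (\<exists>L. homogeneous 1 L \<and>
      (\<forall>i. inj_on (\<lambda>u. cos L \<otimes>\<^bsub>quotient_algebra S\<^esub> u) (graded_component S i) \<or>
        (\<lambda>u. cos L \<otimes>\<^bsub>quotient_algebra S\<^esub> u) ` graded_component S i = graded_component S (Suc i)))"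
    unfolding weak_lefschetz_def gr[of 1] bex_simps(7) by (simp only: Bex_def mem_Collect_eq)
  also have "\<dots> \<longleftrightarrow> (\<exists>L. homogeneous 1 L \<and>
      (\<forall>i. multiplication_injective I L i \<or> multiplication_surjective I L i))"
    using lefschetz_element by (intro ex_cong1 conj_cong refl)
  finally show ?thesis .
qed

text \<open>
  If \<open>L f = 0\<close> in the quotient, then \<open>L (v f) = 0\<close> for every variable \<open>v\<close>, so injectivity in degree \<open>i + 1\<close>
  gives \<open>v f = 0\<close>. An element killed by all variables is a multiple of the one
  monomial in which every exponent is maximal, and this monomial does not have degree \<open>i\<close>.
\<close>
lemma multiplication_injective_descends:
  fixes L :: "('v, 'k::comm_ring_1) multipoly"
  assumes inj: "multiplication_injective (power_ideal e) L (Suc i)"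
    and socle: "\<And>m. (\<forall>v. e v = Suc (lookup m v)) \<Longrightarrow> monomial_degree m \<noteq> i"
  shows "multiplication_injective (power_ideal e) L i"
  unfolding multiplication_injective_def
proof (intro allI impI)
  fix f :: "('v, 'k) multipoly" assume f: "homogeneous i f" "L * f \<in> power_ideal e"
  have up: "indet v * f \<in> power_ideal e" for v
  proof -
    have "L * (indet v * f) \<in> power_ideal e"
      using power_ideal_mult[OF f(2), of "indet v"] by (simp add: mult.left_commute)
    then show ?thesis using inj homogeneous_indet_mult[OF f(1)]
      by (simp add: multiplication_injective_def)
  qed
  show "f \<in> power_ideal e" unfolding power_ideal_iff
  proof (intro allI impI, rule ccontr)
    fix m assume m: "\<forall>v. lookup m v < e v" and nz: "lookup f m \<noteq> 0"
    have "e v = Suc (lookup m v)" for v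
    proof (rule ccontr)
      assume "e v \<noteq> Suc (lookup m v)"
      then have "\<forall>w. lookup (Poly_Mapping.single v 1 + m) w < e w"
        using m by (auto simp: lookup_add lookup_single when_def) (metis Suc_lessI)
      then have "lookup (indet v * f) (Poly_Mapping.single v 1 + m) = 0"
        using up[of v] unfolding power_ideal_iff by blast
      then show False using nz by (simp add: indet_def lookup_monomial_times)
    qed
    then have "monomial_degree m \<noteq> i" using socle by blast
    then show False using f(1) nz by (simp add: homogeneous_def in_keys_iff)
  qed
qed

text \<open>
  A monomial of degree \<open>i + 2\<close> is \<open>v m'\<close> for a variable \<open>v\<close>, and if \<open>f\<close> is mapped to \<open>m'\<close> then \<open>v f\<close> is
  mapped to \<open>v m'\<close>. Linear combinations of monomials follow by addition.
\<close>
lemma multiplication_surjective_ascends: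
  fixes L :: "('v, 'k::comm_ring_1) multipoly"
  assumes surj: "multiplication_surjective (power_ideal e) L i"
  shows "multiplication_surjective (power_ideal e) L (Suc i)"
  unfolding multiplication_surjective_def
proof (intro allI impI)
  fix g :: "('v, 'k) multipoly" assume g: "homogeneous (Suc (Suc i)) g"
  have monomial: "\<exists>f. homogeneous (Suc i) f \<and> Poly_Mapping.single m c - L * f \<in> power_ideal e"
    if "m \<in> keys g" for m c
  proof -
    have deg: "monomial_degree m = Suc (Suc i)" using that g by (auto simp: homogeneous_def)
    then obtain v where "lookup m v \<noteq> 0"
      by (metis monomial_degree_def sum.neutral nat.distinct(1))
    then have m: "Poly_Mapping.single v 1 + (m - Poly_Mapping.single v 1) = m"
      by (intro poly_mapping_eqI) (auto simp: lookup_add lookup_minus lookup_single when_def)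
    define m' where "m' = m - Poly_Mapping.single v 1"
    have "monomial_degree m' = Suc i"
      using deg monomial_degree_add[of "Poly_Mapping.single v 1" m'] m by (simp add: m'_def)
    then obtain f where f: "homogeneous i f" "Poly_Mapping.single m' c - L * f \<in> power_ideal e"
      using surj homogeneous_single unfolding multiplication_surjective_def by blast
    have "Poly_Mapping.single m c = indet v * Poly_Mapping.single m' c"
      using m by (simp add: indet_def mult_single m'_def)
    then have "Poly_Mapping.single m c - L * (indet v * f) = indet v * (Poly_Mapping.single m' c - L * f)"
      by (simp add: algebra_simps)
    then show ?thesis using f homogeneous_indet_mult power_ideal_mult by metis
  qed
  have "\<exists>f. homogeneous (Suc i) f \<and>
      (\<Sum>m\<in>A. Poly_Mapping.single m (lookup g m)) - L * f \<in> power_ideal e"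
    if "finite A" "A \<subseteq> keys g" for A
    using that
  proof (induction A rule: finite_induct)
    case empty
    then show ?case using homogeneous_0 power_ideal_0 by (intro exI[of _ 0]) auto
  next
    case (insert m A)
    then obtain f where f: "homogeneous (Suc i) f"
      "(\<Sum>m\<in>A. Poly_Mapping.single m (lookup g m)) - L * f \<in> power_ideal e" by auto
    obtain h where h: "homogeneous (Suc i) h"
      "Poly_Mapping.single m (lookup g m) - L * h \<in> power_ideal e"
      using monomial insert.prems by blast
    have "(\<Sum>m\<in>insert m A. Poly_Mapping.single m (lookup g m)) - L * (h + f) \<in> power_ideal e"
      using power_ideal_add[OF h(2) f(2)] insert.hyps by (simp add: algebra_simps)
    then show ?case using homogeneous_add[OF h(1) f(1)] by blast
  qed
  from this[of "keys g"]
  show "\<exists>f. homogeneous (Suc i) f \<and> g - L * f \<in> power_ideal e" by (simp add: sum_monomials)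
qed

text \<open>
  Let \<open>\<sigma>\<close> be the socle monomial. If \<open>L f = 0\<close>, then \<open>f\<close> annihilates the image \<open>L A_d\<close>, which is all of
  \<open>A_(d+1)\<close>. But if a monomial \<open>m\<close> outside the ideal occurs in \<open>f\<close>, its complement \<open>\<sigma> - m\<close> has
  degree \<open>d + 1\<close>, and in the product of \<open>f\<close> with it the socle monomial has the nonzero coefficient of \<open>m\<close> in \<open>f\<close>.
\<close>
lemma multiplication_surjective_imp_injective:
  fixes L :: "('v, 'k::comm_ring_1) multipoly"
  assumes surj: "multiplication_surjective (power_ideal e) L d"
    and socle: "\<And>v. e v = Suc (lookup \<sigma> v)" and deg: "monomial_degree \<sigma> = d + Suc d"
  shows "multiplication_injective (power_ideal e) L d"
  unfolding multiplication_injective_def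
proof (intro allI impI)
  fix f :: "('v, 'k) multipoly" assume f: "homogeneous d f" "L * f \<in> power_ideal e"
  show "f \<in> power_ideal e" unfolding power_ideal_iff
  proof (intro allI impI, rule ccontr)
    fix m assume m: "\<forall>v. lookup m v < e v" and nz: "lookup f m \<noteq> 0"
    define m' where "m' = \<sigma> - m"
    have \<sigma>: "m' + m = \<sigma>"
      using m socle by (intro poly_mapping_eqI) (auto simp: m'_def lookup_add lookup_minus less_Suc_eq_le)
    have "monomial_degree m = d" using f(1) nz by (simp add: homogeneous_def in_keys_iff)
    then have "monomial_degree m' = Suc d" using deg monomial_degree_add[of m' m] \<sigma> by simp
    then obtain g where g: "Poly_Mapping.single m' 1 - L * g \<in> power_ideal e"
      using surj homogeneous_single unfolding multiplication_surjective_def by blast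
    have "Poly_Mapping.single m' 1 * f = f * (Poly_Mapping.single m' 1 - L * g) + g * (L * f)"
      by (simp add: algebra_simps)
    also have "\<dots> \<in> power_ideal e"
      by (intro power_ideal_add power_ideal_mult g f)
    finally have "lookup (Poly_Mapping.single m' 1 * f) \<sigma> = 0"
      using socle unfolding power_ideal_iff by simp
    then show False using nz lookup_monomial_times[of m' 1 f m] by (simp add: \<sigma>)
  qed
qed

theorem weak_lefschetz_imp_middle_injective:
  fixes e :: "'v \<Rightarrow> nat" and S :: "('v, 'k::comm_ring_1) multipoly set"
  defines "S \<equiv> range (\<lambda>v. indet v ^ e v)"
  assumes socle: "\<And>v. e v = Suc (lookup \<sigma> v)" and deg: "monomial_degree \<sigma> = d + Suc d"
    and "weak_lefschetz (quotient_algebra S) (graded_component S)"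
  obtains L :: "('v, 'k) multipoly" where "homogeneous 1 L" "multiplication_injective (power_ideal e) L d"
proof -
  obtain L :: "('v, 'k) multipoly" where L: "homogeneous 1 L"
    "multiplication_injective (power_ideal e) L d \<or> multiplication_surjective (power_ideal e) L d"
    using assms(4) unfolding weak_lefschetz_quotient_algebra S_def genideal_pure_powers by blast
  moreover have "multiplication_injective (power_ideal e) L d"
    if "multiplication_surjective (power_ideal e) L d"
    using that socle deg by (rule multiplication_surjective_imp_injective)
  ultimately show thesis using that by blast
qed

theorem middle_bijective_imp_weak_lefschetz:
  fixes e :: "'v \<Rightarrow> nat" and S :: "('v, 'k::comm_ring_1) multipoly set" and L :: "('v, 'k) multipoly"
  defines "S \<equiv> range (\<lambda>v. indet v ^ e v)"
  assumes socle: "\<And>v. e v = Suc (lookup \<sigma> v)" and deg: "monomial_degree \<sigma> > d"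
    and L: "homogeneous 1 L" and inj: "multiplication_injective (power_ideal e) L d"
    and surj: "multiplication_surjective (power_ideal e) L d"
  shows "weak_lefschetz (quotient_algebra S) (graded_component S)"
proof -
  have "multiplication_injective (power_ideal e) L i \<or> multiplication_surjective (power_ideal e) L i" for i
  proof (cases "i \<le> d")
    case True
    then have "multiplication_injective (power_ideal e) L i"
    proof (induction i rule: inc_induct)
      case (step i)
      have "monomial_degree m \<noteq> i" if "\<forall>v. e v = Suc (lookup m v)" for m
      proof -
        have "m = \<sigma>" using that socle by (intro poly_mapping_eqI) simp
        then show ?thesis using deg step by simp
      qed
      then show ?case using multiplication_injective_descends[OF step.IH] by blast
    qed (rule inj)
    then show ?thesis ..
  next
    case False
    then have "d \<le> i" by simp
    then have "multiplication_surjective (power_ideal e) L i"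
      by (induction i rule: dec_induct) (auto intro: surj multiplication_surjective_ascends)
    then show ?thesis ..
  qed
  then show ?thesis using L
    unfolding weak_lefschetz_quotient_algebra S_def genideal_pure_powers by blast
qed

section \<open>Forms in three variables as coefficient arrays\<close>

definition exponents :: "nat \<Rightarrow> nat \<Rightarrow> nat \<Rightarrow> xyz \<Rightarrow>\<^sub>0 nat" where
  "exponents i j k =
     Poly_Mapping.single VarX i + Poly_Mapping.single VarY j + Poly_Mapping.single VarZ k"

lemma lookup_exponents [simp]:
  "lookup (exponents i j k) VarX = i"
  "lookup (exponents i j k) VarY = j"
  "lookup (exponents i j k) VarZ = k"
  by (simp_all add: exponents_def lookup_add lookup_single)

lemma all_xyz: "(\<forall>v. P v) \<longleftrightarrow> P VarX \<and> P VarY \<and> P VarZ"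
  by (metis xyz.exhaust)

lemma exponents_eqI:
  "lookup m VarX = i \<Longrightarrow> lookup m VarY = j \<Longrightarrow> lookup m VarZ = k \<Longrightarrow> m = exponents i j k"
proof (rule poly_mapping_eqI)
  fix v
  assume "lookup m VarX = i" "lookup m VarY = j" "lookup m VarZ = k"
  then show "lookup m v = lookup (exponents i j k) v" by (cases v) simp_all
qed

lemma exponents_lookup: "exponents (lookup m VarX) (lookup m VarY) (lookup m VarZ) = m"
  by (rule exponents_eqI[symmetric]) simp_all

lemma monomial_degree_exponents [simp]: "monomial_degree (exponents i j k) = i + j + k"
  by (simp add: exponents_def monomial_degree_add)

definition box_exponents :: "nat \<Rightarrow> nat \<Rightarrow> nat \<Rightarrow> xyz \<Rightarrow> nat" where
  "box_exponents l m n v = (case v of VarX \<Rightarrow> l | VarY \<Rightarrow> m | VarZ \<Rightarrow> n)"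

lemma pure_powers_eq_range: "pure_powers l m n = range (\<lambda>v. indet v ^ box_exponents l m n v)"
proof -
  have UNIV: "(UNIV :: xyz set) = {VarX, VarY, VarZ}" using xyz.exhaust by blast
  show ?thesis by (simp add: UNIV pure_powers_def box_exponents_def)
qed

lemma power_ideal_box_iff:
  "f \<in> power_ideal (box_exponents l m n) \<longleftrightarrow>
     (\<forall>i j k. i < l \<longrightarrow> j < m \<longrightarrow> k < n \<longrightarrow> lookup f (exponents i j k) = 0)"
proof
  assume "f \<in> power_ideal (box_exponents l m n)"
  then show "\<forall>i j k. i < l \<longrightarrow> j < m \<longrightarrow> k < n \<longrightarrow> lookup f (exponents i j k) = 0"
    by (simp add: power_ideal_iff all_xyz box_exponents_def)
next
  assume *: "\<forall>i j k. i < l \<longrightarrow> j < m \<longrightarrow> k < n \<longrightarrow> lookup f (exponents i j k) = 0"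
  show "f \<in> power_ideal (box_exponents l m n)" unfolding power_ideal_iff
  proof (intro allI impI)
    fix u assume "\<forall>v. lookup u v < box_exponents l m n v"
    then show "lookup f u = 0"
      using *[rule_format, of "lookup u VarX" "lookup u VarY" "lookup u VarZ"]
      by (simp add: exponents_lookup all_xyz box_exponents_def)
  qed
qed

definition linear_form :: "'k \<Rightarrow> 'k \<Rightarrow> 'k \<Rightarrow> (xyz, 'k::comm_ring_1) multipoly" where
  "linear_form \<alpha> \<beta> \<gamma> = Poly_Mapping.single (exponents 1 0 0) \<alpha> +
     Poly_Mapping.single (exponents 0 1 0) \<beta> + Poly_Mapping.single (exponents 0 0 1) \<gamma>"

lemma homogeneous_linear_form: "homogeneous 1 (linear_form \<alpha> \<beta> \<gamma>)"
  unfolding linear_form_def by (intro homogeneous_add homogeneous_single) simp_all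

lemma exponents_inject: "exponents i j k = exponents i' j' k' \<longleftrightarrow> i = i' \<and> j = j' \<and> k = k'"
  by (metis lookup_exponents)

lemma homogeneous_1_obtains_linear_form:
  assumes "homogeneous 1 L"
  obtains \<alpha> \<beta> \<gamma> where "L = linear_form \<alpha> \<beta> \<gamma>"
proof
  let ?\<alpha> = "lookup L (exponents 1 0 0)"
  let ?\<beta> = "lookup L (exponents 0 1 0)"
  let ?\<gamma> = "lookup L (exponents 0 0 1)"
  show "L = linear_form ?\<alpha> ?\<beta> ?\<gamma>"
  proof (rule poly_mapping_eqI)
    fix m
    obtain i j k where m: "m = exponents i j k" by (metis exponents_lookup)
    show "lookup L m = lookup (linear_form ?\<alpha> ?\<beta> ?\<gamma>) m"
    proof (cases "i + j + k = 1")
      case True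
      then consider "i = 1" "j = 0" "k = 0" | "i = 0" "j = 1" "k = 0" | "i = 0" "j = 0" "k = 1"
        by linarith
      then show ?thesis
        by cases (simp_all add: m linear_form_def lookup_add lookup_single exponents_inject)
    next
      case False
      then have "lookup L m = 0" and "lookup (linear_form ?\<alpha> ?\<beta> ?\<gamma>) m = 0"
        using homogeneous_lookup_eq_0[OF assms] homogeneous_lookup_eq_0[OF homogeneous_linear_form[of ?\<alpha> ?\<beta> ?\<gamma>]]
        by (simp_all add: m)
      then show ?thesis by simp
    qed
  qed
qed

text \<open>
  The effect of multiplication by \<open>\<alpha> x + \<beta> y + \<gamma> z\<close> on the coefficient of \<open>x^i y^j z^k\<close>, when \<open>F\<close> is the
  array of coefficients of the other factor.
\<close>
definition times_linear ::
  "'k::comm_ring_1 \<Rightarrow> 'k \<Rightarrow> 'k \<Rightarrow> (nat \<Rightarrow> nat \<Rightarrow> nat \<Rightarrow> 'k) \<Rightarrow> nat \<Rightarrow> nat \<Rightarrow> nat \<Rightarrow> 'k" where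
  "times_linear \<alpha> \<beta> \<gamma> F i j k =
     (if i = 0 then 0 else \<alpha> * F (i - 1) j k) +
     (if j = 0 then 0 else \<beta> * F i (j - 1) k) +
     (if k = 0 then 0 else \<gamma> * F i j (k - 1))"

lemma lookup_linear_form_times:
  "lookup (linear_form \<alpha> \<beta> \<gamma> * f) (exponents i j k) =
     times_linear \<alpha> \<beta> \<gamma> (\<lambda>i j k. lookup f (exponents i j k)) i j k"
proof -
  have add: "exponents i j k + exponents i' j' k' = exponents (i + i') (j + j') (k + k')"
    for i j k i' j' k'
    by (rule exponents_eqI) (simp_all add: lookup_add)
  have zero: "lookup (Poly_Mapping.single (exponents i' j' k') c * f) (exponents i j k) = 0"
    if "i < i' \<or> j < j' \<or> k < k'" for i' j' k' c
  proof (rule lookup_monomial_times_not_multiple)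
    fix m show "exponents i j k \<noteq> exponents i' j' k' + m"
      using that by (metis add exponents_inject exponents_lookup not_add_less1)
  qed
  have "lookup (Poly_Mapping.single (exponents 1 0 0) \<alpha> * f) (exponents i j k) =
      (if i = 0 then 0 else \<alpha> * lookup f (exponents (i - 1) j k))"
    using zero[of 1 0 0] lookup_monomial_times[of "exponents 1 0 0" \<alpha> f "exponents (i - 1) j k"]
    by (cases i) (simp_all add: add)
  moreover have "lookup (Poly_Mapping.single (exponents 0 1 0) \<beta> * f) (exponents i j k) =
      (if j = 0 then 0 else \<beta> * lookup f (exponents i (j - 1) k))"
    using zero[of 0 1 0] lookup_monomial_times[of "exponents 0 1 0" \<beta> f "exponents i (j - 1) k"]
    by (cases j) (simp_all add: add)
  moreover have "lookup (Poly_Mapping.single (exponents 0 0 1) \<gamma> * f) (exponents i j k) =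
      (if k = 0 then 0 else \<gamma> * lookup f (exponents i j (k - 1)))"
    using zero[of 0 0 1] lookup_monomial_times[of "exponents 0 0 1" \<gamma> f "exponents i j (k - 1)"]
    by (cases k) (simp_all add: add)
  ultimately show ?thesis
    by (simp only: linear_form_def times_linear_def distrib_right lookup_add)
qed

lemma form_with_coefficients:
  fixes F :: "nat \<Rightarrow> nat \<Rightarrow> nat \<Rightarrow> 'k::comm_ring_1"
  obtains f where "homogeneous d f"
    and "\<And>i j k. i + j + k = d \<Longrightarrow> lookup f (exponents i j k) = F i j k"
proof
  define f where "f = (\<Sum>(i, j, k)\<in>{(i, j, k). i \<le> d \<and> j \<le> d \<and> k \<le> d \<and> i + j + k = d}.
      Poly_Mapping.single (exponents i j k) (F i j k))"
  let ?A = "{(i, j, k). i \<le> d \<and> j \<le> d \<and> k \<le> d \<and> i + j + k = d}"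
  have fin: "finite ?A"
    by (rule finite_subset[of _ "{..d} \<times> {..d} \<times> {..d}"]) auto
  have "homogeneous d (\<Sum>(i, j, k)\<in>B. Poly_Mapping.single (exponents i j k) (F i j k))"
    if "finite B" "B \<subseteq> ?A" for B
    using that
    by (induction B rule: finite_induct) (auto intro!: homogeneous_0 homogeneous_add homogeneous_single)
  from this[OF fin] show "homogeneous d f" by (simp add: f_def)
  fix i j k assume ijk: "i + j + k = d"
  have "lookup f (exponents i j k) =
      (\<Sum>t\<in>?A. case t of (i', j', k') \<Rightarrow> lookup (Poly_Mapping.single (exponents i' j' k') (F i' j' k')) (exponents i j k))"
    by (simp add: f_def lookup_sum case_prod_unfold)
  also have "\<dots> = (\<Sum>t\<in>?A. if t = (i, j, k) then F i j k else 0)"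
    by (rule sum.cong) (auto simp: lookup_single exponents_inject when_def split: if_splits)
  also have "\<dots> = F i j k" using fin ijk by (simp add: sum.delta)
  finally show "lookup f (exponents i j k) = F i j k" .
qed

lemma times_linear_cong:
  assumes "\<And>i' j' k'. i' \<le> i \<Longrightarrow> j' \<le> j \<Longrightarrow> k' \<le> k \<Longrightarrow> i' + j' + k' + 1 = i + j + k \<Longrightarrow> F i' j' k' = G i' j' k'"
  shows "times_linear \<alpha> \<beta> \<gamma> F i j k = times_linear \<alpha> \<beta> \<gamma> G i j k"
  using assms[of "i - 1" j k] assms[of i "j - 1" k] assms[of i j "k - 1"]
  by (cases i; cases j; cases k) (simp_all add: times_linear_def)

text \<open>
  Only the values of \<open>F\<close> in degree \<open>d\<close> enter on the right-hand side, so \<open>F\<close> may be an arbitrary array: it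
  is replaced by the form of degree \<open>d\<close> with these coefficients.
\<close>
lemma multiplication_injective_box_iff:
  fixes \<alpha> \<beta> \<gamma> :: "'k::comm_ring_1"
  shows
  "multiplication_injective (power_ideal (box_exponents l m n)) (linear_form \<alpha> \<beta> \<gamma>) d \<longleftrightarrow>
   (\<forall>F. (\<forall>i j k. i < l \<longrightarrow> j < m \<longrightarrow> k < n \<longrightarrow> i + j + k = Suc d \<longrightarrow> times_linear \<alpha> \<beta> \<gamma> F i j k = 0) \<longrightarrow>
      (\<forall>i j k. i < l \<longrightarrow> j < m \<longrightarrow> k < n \<longrightarrow> i + j + k = d \<longrightarrow> F i j k = 0))"
  (is "?inj \<longleftrightarrow> (\<forall>F. ?ker F \<longrightarrow> ?zero F)")
proof (intro iffI allI impI)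
  fix F i j k
  assume inj: ?inj and ker: "?ker F" and box: "i < l" "j < m" "k < n" and deg: "i + j + k = d"
  obtain f where f: "homogeneous d f" "\<And>i j k. i + j + k = d \<Longrightarrow> lookup f (exponents i j k) = F i j k"
    by (rule form_with_coefficients[of d F]) blast
  have "linear_form \<alpha> \<beta> \<gamma> * f \<in> power_ideal (box_exponents l m n)" unfolding power_ideal_box_iff
  proof (intro allI impI)
    fix i j k assume box: "i < l" "j < m" "k < n"
    show "lookup (linear_form \<alpha> \<beta> \<gamma> * f) (exponents i j k) = 0"
    proof (cases "i + j + k = Suc d")
      case True
      then have "times_linear \<alpha> \<beta> \<gamma> (\<lambda>i j k. lookup f (exponents i j k)) i j k = times_linear \<alpha> \<beta> \<gamma> F i j k"
        by (intro times_linear_cong f(2)) simp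
      then show ?thesis using ker box True by (simp add: lookup_linear_form_times)
    next
      case False
      then show ?thesis
        using homogeneous_lookup_eq_0[OF homogeneous_mult[OF homogeneous_linear_form f(1)]] by simp
    qed
  qed
  then have "f \<in> power_ideal (box_exponents l m n)"
    using inj f(1) by (simp add: multiplication_injective_def)
  then show "F i j k = 0" using f(2)[OF deg] box by (simp add: power_ideal_box_iff)
next
  assume *: "\<forall>F. ?ker F \<longrightarrow> ?zero F"
  show ?inj unfolding multiplication_injective_def
  proof (intro allI impI)
    fix f :: "(xyz, 'k) multipoly"
    assume f: "homogeneous d f" "linear_form \<alpha> \<beta> \<gamma> * f \<in> power_ideal (box_exponents l m n)"
    have "?zero (\<lambda>i j k. lookup f (exponents i j k))"
      using f(2) by (intro *[THEN spec, THEN mp]) (simp add: power_ideal_box_iff lookup_linear_form_times)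
    then show "f \<in> power_ideal (box_exponents l m n)"
      unfolding power_ideal_box_iff using homogeneous_lookup_eq_0[OF f(1)]
      by (metis monomial_degree_exponents)
  qed
qed

lemma multiplication_surjective_boxI:
  fixes \<alpha> \<beta> \<gamma> :: "'k::comm_ring_1"
  assumes "\<And>G. \<exists>F. \<forall>i j k. i < l \<longrightarrow> j < m \<longrightarrow> k < n \<longrightarrow> i + j + k = Suc d \<longrightarrow>
      times_linear \<alpha> \<beta> \<gamma> F i j k = G i j k"
  shows "multiplication_surjective (power_ideal (box_exponents l m n)) (linear_form \<alpha> \<beta> \<gamma>) d"
  unfolding multiplication_surjective_def
proof (intro allI impI)
  fix g :: "(xyz, 'k) multipoly" assume g: "homogeneous (Suc d) g"
  obtain F where F: "\<And>i j k. i < l \<Longrightarrow> j < m \<Longrightarrow> k < n \<Longrightarrow> i + j + k = Suc d \<Longrightarrow>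
      times_linear \<alpha> \<beta> \<gamma> F i j k = lookup g (exponents i j k)"
    using assms[of "\<lambda>i j k. lookup g (exponents i j k)"] by blast
  obtain f where f: "homogeneous d f" "\<And>i j k. i + j + k = d \<Longrightarrow> lookup f (exponents i j k) = F i j k"
    by (rule form_with_coefficients[of d F]) blast
  have "g - linear_form \<alpha> \<beta> \<gamma> * f \<in> power_ideal (box_exponents l m n)" unfolding power_ideal_box_iff
  proof (intro allI impI)
    fix i j k assume box: "i < l" "j < m" "k < n"
    show "lookup (g - linear_form \<alpha> \<beta> \<gamma> * f) (exponents i j k) = 0"
    proof (cases "i + j + k = Suc d")
      case True
      then have "times_linear \<alpha> \<beta> \<gamma> (\<lambda>i j k. lookup f (exponents i j k)) i j k = times_linear \<alpha> \<beta> \<gamma> F i j k"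
        by (intro times_linear_cong f(2)) simp
      then show ?thesis using F[OF box True] by (simp add: lookup_minus lookup_linear_form_times)
    next
      case False
      then show ?thesis
        using homogeneous_lookup_eq_0[OF homogeneous_mult[OF homogeneous_linear_form f(1)]]
          homogeneous_lookup_eq_0[OF g] by (simp add: lookup_minus)
    qed
  qed
  then show "\<exists>f. homogeneous d f \<and> g - linear_form \<alpha> \<beta> \<gamma> * f \<in> power_ideal (box_exponents l m n)"
    using f(1) by blast
qed

section \<open>The middle degree\<close>

text \<open>
  Injectivity of \<open>\<alpha> x + \<beta> y + \<gamma> z\<close> on degree \<open>a + b + c - 2\<close>, in coordinates. The degrees are stated
  without subtraction.
\<close>
definition middle_injective :: "nat \<Rightarrow> nat \<Rightarrow> nat \<Rightarrow> 'k::comm_ring_1 \<Rightarrow> 'k \<Rightarrow> 'k \<Rightarrow> bool" where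
  "middle_injective a b c \<alpha> \<beta> \<gamma> \<longleftrightarrow>
     (\<forall>F. (\<forall>i j k. i < a + b \<longrightarrow> j < a + c \<longrightarrow> k < b + c \<longrightarrow> i + j + k + 1 = a + b + c \<longrightarrow>
             times_linear \<alpha> \<beta> \<gamma> F i j k = 0) \<longrightarrow>
          (\<forall>i j k. i < a + b \<longrightarrow> j < a + c \<longrightarrow> k < b + c \<longrightarrow> i + j + k + 2 = a + b + c \<longrightarrow>
             F i j k = 0))"

lemma middle_injectiveD:
  assumes "middle_injective a b c \<alpha> \<beta> \<gamma>"
    and "\<And>i j k. i < a + b \<Longrightarrow> j < a + c \<Longrightarrow> k < b + c \<Longrightarrow> i + j + k + 1 = a + b + c \<Longrightarrow>
             times_linear \<alpha> \<beta> \<gamma> F i j k = 0"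
    and "i < a + b" "j < a + c" "k < b + c" "i + j + k + 2 = a + b + c"
  shows "F i j k = 0"
  using assms unfolding middle_injective_def by blast

text \<open>
  Exchanging two variables exchanges two of the three exponents \<open>a + b\<close>, \<open>a + c\<close>, \<open>b + c\<close>, which amounts to
  exchanging two of the parameters. This reduces statements about single coefficients of the linear form
  to the coefficient of \<open>z\<close>.
\<close>
lemma middle_injective_swap_yz:
  assumes "middle_injective a b c \<alpha> \<beta> \<gamma>"
  shows "middle_injective b a c \<alpha> \<gamma> \<beta>"
  unfolding middle_injective_def
proof (intro allI impI)
  fix F i j k
  assume ker: "\<forall>i j k. i < b + a \<longrightarrow> j < b + c \<longrightarrow> k < a + c \<longrightarrow> i + j + k + 1 = b + a + c \<longrightarrow>
      times_linear \<alpha> \<gamma> \<beta> F i j k = 0"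
    and ijk: "i < b + a" "j < b + c" "k < a + c" "i + j + k + 2 = b + a + c"
  have "times_linear \<alpha> \<beta> \<gamma> (\<lambda>i j k. F i k j) i j k = times_linear \<alpha> \<gamma> \<beta> F i k j" for i j k
    by (simp add: times_linear_def add.commute add.left_commute)
  then show "F i j k = 0"
    using ker ijk
    by (intro middle_injectiveD[OF assms, where F = "\<lambda>i j k. F i k j" and i = i and j = k and k = j])
       (simp_all add: add.commute add.left_commute)
qed

lemma middle_injective_swap_xz:
  assumes "middle_injective a b c \<alpha> \<beta> \<gamma>"
  shows "middle_injective c b a \<gamma> \<beta> \<alpha>"
  unfolding middle_injective_def
proof (intro allI impI)
  fix F i j k
  assume ker: "\<forall>i j k. i < c + b \<longrightarrow> j < c + a \<longrightarrow> k < b + a \<longrightarrow> i + j + k + 1 = c + b + a \<longrightarrow>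
      times_linear \<gamma> \<beta> \<alpha> F i j k = 0"
    and ijk: "i < c + b" "j < c + a" "k < b + a" "i + j + k + 2 = c + b + a"
  have "times_linear \<alpha> \<beta> \<gamma> (\<lambda>i j k. F k j i) i j k = times_linear \<gamma> \<beta> \<alpha> F k j i" for i j k
    by (simp add: times_linear_def add.commute add.left_commute)
  then show "F i j k = 0"
    using ker ijk
    by (intro middle_injectiveD[OF assms, where F = "\<lambda>i j k. F k j i" and i = k and j = j and k = i])
       (simp_all add: add.commute add.left_commute)
qed

text \<open>
  Modulo \<open>x^(a+b)\<close> and \<open>y^(a+c)\<close>, there are \<open>a + 1\<close> monomials of degree \<open>a + b + c - 2\<close> in \<open>x\<close> and \<open>y\<close> but only
  \<open>a\<close> of the next degree, so \<open>\<alpha> x + \<beta> y\<close> cannot be injective. A kernel element is the geometric sum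
  of the terms \<open>\<beta>^r (-\<alpha>)^s x^i y^j\<close> over these \<open>a + 1\<close> monomials, where \<open>r\<close> and \<open>s\<close> are the distances of \<open>i\<close> from
  the largest and the smallest possible exponent of \<open>x\<close>. It is nonzero unless \<open>\<alpha> = \<beta> = 0\<close>, and in that
  case the whole degree is the kernel.
\<close>
lemma middle_injective_nonzero_z:
  fixes \<alpha> \<beta> \<gamma> :: "'k::field"
  assumes inj: "middle_injective a b c \<alpha> \<beta> \<gamma>" and pos: "a > 0" "b > 0" "c > 0"
  shows "\<gamma> \<noteq> 0"
proof
  assume \<gamma>: "\<gamma> = 0"
  show False
  proof (cases "\<alpha> = 0 \<and> \<beta> = 0")
    case True
    have "(1 :: 'k) = 0"
      by (rule middle_injectiveD[OF inj, where F = "\<lambda>_ _ _. 1" and i = "b - 1" and j = "a + c - 1" and k = 0])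
         (use True \<gamma> pos in \<open>simp_all add: times_linear_def\<close>)
    then show False by simp
  next
    case False
    define F :: "nat \<Rightarrow> nat \<Rightarrow> nat \<Rightarrow> 'k" where
      "F i j k = (if k = 0 then \<beta> ^ (a + b - 1 - i) * (- \<alpha>) ^ (i - (b - 1)) else 0)" for i j k
    have ker: "times_linear \<alpha> \<beta> \<gamma> F i j k = 0"
      if box: "i < a + b" "j < a + c" "k < b + c" and deg: "i + j + k + 1 = a + b + c" for i j k
    proof (cases "k = 0")
      case True
      then have ij: "i \<ge> b" "j \<ge> c" using box deg by linarith+
      have "a + b - 1 - (i - 1) = Suc (a + b - 1 - i)" "i - (b - 1) = Suc (i - b)"
        "i - 1 - (b - 1) = i - b"
        using ij pos box by linarith+
      then show ?thesis using ij pos True by (simp add: times_linear_def F_def \<gamma>)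
    next
      case False
      then show ?thesis by (simp add: times_linear_def F_def \<gamma>)
    qed
    \<comment> \<open>The two extreme coefficients are \<open>\<beta>^a\<close> and \<open>(-\<alpha>)^a\<close>.\<close>
    have "F (b - 1) (a + c - 1) 0 = 0"
      by (rule middle_injectiveD[OF inj, where F = F, OF ker]) (use pos in simp_all)
    moreover have "F (a + b - 1) (c - 1) 0 = 0"
      by (rule middle_injectiveD[OF inj, where F = F, OF ker]) (use pos in simp_all)
    ultimately show False using False pos by (auto simp: F_def)
  qed
qed

lemma middle_injective_nonzero:
  fixes \<alpha> \<beta> \<gamma> :: "'k::field"
  assumes inj: "middle_injective a b c \<alpha> \<beta> \<gamma>" and pos: "a > 0" "b > 0" "c > 0"
  shows "\<alpha> \<noteq> 0" "\<beta> \<noteq> 0" "\<gamma> \<noteq> 0"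
  using middle_injective_nonzero_z[OF inj] middle_injective_nonzero_z[OF middle_injective_swap_xz[OF inj]]
    middle_injective_nonzero_z[OF middle_injective_swap_yz[OF inj]] pos by simp_all

text \<open>
  The coefficient of \<open>x^i\<close> in \<open>(x + y)^r g\<close>, where \<open>g\<close> is the sum of \<open>v s x^s y^(a-1-s)\<close> over \<open>s < a\<close>. The
  exponent of \<open>y\<close> is determined by the degree.
\<close>
definition power_coefficient :: "nat \<Rightarrow> (nat \<Rightarrow> 'k::comm_ring_1) \<Rightarrow> nat \<Rightarrow> nat \<Rightarrow> 'k" where
  "power_coefficient a v r i = (\<Sum>s<a. v s * of_int (zbinom r (int i - int s)))"

lemma power_coefficient_0: "i < a \<Longrightarrow> power_coefficient a v 0 i = v i"
  by (simp add: power_coefficient_def zbinom_0 of_bool_def if_distrib sum.delta cong: if_cong)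

lemma power_coefficient_Suc:
  "power_coefficient a v (Suc r) i =
     (if i = 0 then 0 else power_coefficient a v r (i - 1)) + power_coefficient a v r i"
proof (cases i)
  case 0
  have "zbinom r (- int s - 1) = 0" for s by (simp add: zbinom_def)
  then show ?thesis using 0 by (simp add: power_coefficient_def zbinom_Suc)
next
  case (Suc i')
  then show ?thesis
    by (simp add: power_coefficient_def zbinom_Suc algebra_simps sum.distrib)
qed

lemma power_coefficient_eq_0: "i \<ge> a + r \<Longrightarrow> power_coefficient a v r i = 0"
proof -
  assume "i \<ge> a + r"
  then have "zbinom r (int i - int s) = 0" if "s < a" for s
    using that by (simp add: zbinom_def binomial_eq_0)
  then show ?thesis by (simp add: power_coefficient_def)
qed

text \<open>
  The coefficient of \<open>z^k\<close> is \<open>(- (x + y))^(n-k) g\<close>, with \<open>g\<close> as above and \<open>n\<close> the largest exponent of \<open>z\<close>.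
\<close>
definition kernel_candidate :: "nat \<Rightarrow> nat \<Rightarrow> (nat \<Rightarrow> 'k::comm_ring_1) \<Rightarrow> nat \<Rightarrow> nat \<Rightarrow> nat \<Rightarrow> 'k" where
  "kernel_candidate a n v i j k = (- 1) ^ (n - k) * power_coefficient a v (n - k) i"

text \<open>
  The products telescope: \<open>x + y\<close> times the coefficient of \<open>z^k\<close> cancels the coefficient of \<open>z^(k-1)\<close>.
  Only \<open>(x + y)^(n+1) g\<close> is left over, at \<open>z^0\<close>.
\<close>
lemma times_linear_kernel_candidate:
  assumes "k \<le> n" and "i + j + k = a + n"
  shows "times_linear 1 1 1 (kernel_candidate a n v) i j k =
     (if k = 0 then (- 1) ^ n * power_coefficient a v (Suc n) i else 0)"
proof -
  \<comment> \<open>A monomial without \<open>y\<close> has no \<open>y\<close>-neighbour, whereas the formula for the coefficient would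
    provide one; it is harmless, as \<open>i\<close> then exceeds the degree of the form.\<close>
  have j0: "power_coefficient a v (n - k) i = 0" if "j = 0"
    using assms that by (intro power_coefficient_eq_0) simp
  have "times_linear 1 1 1 (kernel_candidate a n v) i j k =
      (- 1) ^ (n - k) * power_coefficient a v (Suc (n - k)) i +
      (if k = 0 then 0 else kernel_candidate a n v i j (k - 1))"
    using j0 by (cases "i = 0"; cases "j = 0")
      (simp_all add: times_linear_def kernel_candidate_def power_coefficient_Suc[of a v "n - k"] algebra_simps)
  moreover have "kernel_candidate a n v i j (k - 1) =
      - ((- 1) ^ (n - k) * power_coefficient a v (Suc (n - k)) i)" if "k \<noteq> 0"
  proof -
    have "n - (k - 1) = Suc (n - k)" using that assms(1) by simp
    then show ?thesis by (simp add: kernel_candidate_def)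
  qed
  ultimately show ?thesis by simp
qed

text \<open>
  The equation at \<open>(i, j, k + 1)\<close> expresses \<open>F i j k\<close> by values of \<open>F\<close> with third index \<open>k + 1\<close>. Hence the
  values at \<open>k = n\<close>, which are the coefficients of \<open>g\<close>, determine all others, and the kernel candidate
  solves the same equations with the same values at \<open>k = n\<close>.
\<close>
lemma kernel_candidate_unique:
  fixes F :: "nat \<Rightarrow> nat \<Rightarrow> nat \<Rightarrow> 'k::comm_ring_1"
  assumes ker: "\<And>i j k. i < l \<Longrightarrow> j < m \<Longrightarrow> k \<le> n \<Longrightarrow> i + j + k = a + n \<Longrightarrow> k \<noteq> 0 \<Longrightarrow>
      times_linear 1 1 1 F i j k = 0"
    and ijk: "i < l" "j < m" "k \<le> n" "i + j + k + 1 = a + n"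
  shows "F i j k = kernel_candidate a n (\<lambda>s. F s (a - 1 - s) n) i j k"
  using \<open>k \<le> n\<close> ijk
proof (induction k arbitrary: i j rule: inc_induct)
  case base
  then have "j = a - 1 - i" "i < a" by auto
  then show ?case by (simp add: kernel_candidate_def power_coefficient_0)
next
  case (step k)
  let ?G = "kernel_candidate a n (\<lambda>s. F s (a - 1 - s) n)"
  have "times_linear 1 1 1 F i j (Suc k) = 0"
    using step by (intro ker) simp_all
  moreover have "times_linear 1 1 1 ?G i j (Suc k) = 0"
    using step by (subst times_linear_kernel_candidate) simp_all
  moreover have "i \<noteq> 0 \<longrightarrow> F (i - 1) j (Suc k) = ?G (i - 1) j (Suc k)"
    and "j \<noteq> 0 \<longrightarrow> F i (j - 1) (Suc k) = ?G i (j - 1) (Suc k)"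
    using step by simp_all
  moreover from this have "times_linear 1 1 1 F i j (Suc k) - F i j k =
      times_linear 1 1 1 ?G i j (Suc k) - ?G i j k"
    by (cases "i = 0"; cases "j = 0") (simp_all add: times_linear_def)
  ultimately show ?case by simp
qed

text \<open>
  The matrix of multiplication by \<open>(x + y)^(b+c)\<close> from degree \<open>a - 1\<close> to degree \<open>a + b + c - 1\<close> in
  \<open>K[x,y]/(x^(a+b), y^(a+c))\<close>, for the bases \<open>x^s y^(a-1-s)\<close> and \<open>x^(b+t) y^(a+c-1-t)\<close>.
\<close>
definition path_matrix :: "nat \<Rightarrow> nat \<Rightarrow> nat \<Rightarrow> 'k::comm_ring_1 mat" where
  "path_matrix a b c = mat a a (\<lambda>(t, s). of_int (zbinom (b + c) (int b + int t - int s)))"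

lemma path_matrix_carrier: "path_matrix a b c \<in> carrier_mat a a"
  by (simp add: path_matrix_def)

lemma det_path_matrix:
  "det (path_matrix a b c) = (of_nat (card (plane_partitions_in_box a b c)) :: 'k::comm_ring_1)"
proof -
  let ?B = "binomial_matrix a (b + c) (\<lambda>_. int b)"
  have "(path_matrix a b c :: 'k mat) = transpose_mat (map_mat of_int ?B)"
    by (intro eq_matI) (simp_all add: path_matrix_def binomial_matrix_def algebra_simps)
  moreover have "det (transpose_mat (map_mat of_int ?B :: 'k mat)) = det (map_mat of_int ?B)"
    by (rule det_transpose[of _ a]) (simp add: binomial_matrix_def)
  moreover have "det (map_mat of_int ?B :: 'k mat) = of_int (det ?B)"
    by (rule of_int_hom.hom_det)
  ultimately show ?thesis
    by (simp flip: card_plane_partitions_in_box)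
qed

lemma path_matrix_mult_vec:
  assumes "t < a"
  shows "(path_matrix a b c *\<^sub>v vec a v) $ t = power_coefficient a v (b + c) (b + t)"
  using assms
  by (simp add: path_matrix_def power_coefficient_def scalar_prod_def lessThan_atLeast0 mult.commute)

text \<open>
  A nonzero vector in the kernel of the matrix gives a form annihilated by \<open>x + y + z\<close>. Substituting
  \<open>\<alpha> x\<close>, \<open>\<beta> y\<close> and \<open>\<gamma> z\<close> for the variables turns it into a form annihilated by \<open>\<alpha> x + \<beta> y + \<gamma> z\<close>, which
  remains nonzero because the three coefficients are.
\<close>
lemma middle_injective_imp_det_nonzero:
  fixes \<alpha> \<beta> \<gamma> :: "'k::field"
  assumes inj: "middle_injective a b c \<alpha> \<beta> \<gamma>" and pos: "a > 0" "b > 0" "c > 0"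
  shows "det (path_matrix a b c :: 'k mat) \<noteq> 0"
proof
  let ?M = "path_matrix a b c :: 'k mat"
  assume "det ?M = 0"
  then obtain w where w: "w \<in> carrier_vec a" "w \<noteq> 0\<^sub>v a" "?M *\<^sub>v w = 0\<^sub>v a"
    using det_0_iff_vec_prod_zero_field[OF path_matrix_carrier] by blast
  define v where "v s = w $ s" for s
  have w_eq: "w = vec a v" using w(1) by (intro eq_vecI) (simp_all add: v_def)
  then obtain s where s: "s < a" "v s \<noteq> 0" using w(2) by (auto simp: vec_eq_iff)
  obtain n where n: "b + c = Suc n" using pos by (cases "b + c") auto
  define F where "F i j k = \<alpha> ^ i * \<beta> ^ j * \<gamma> ^ k * kernel_candidate a n v i j k" for i j k
  have "times_linear \<alpha> \<beta> \<gamma> F i j k = 0"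
    if box: "i < a + b" "j < a + c" "k < b + c" and deg: "i + j + k + 1 = a + b + c" for i j k
  proof -
    have "times_linear \<alpha> \<beta> \<gamma> F i j k =
        \<alpha> ^ i * \<beta> ^ j * \<gamma> ^ k * times_linear 1 1 1 (kernel_candidate a n v) i j k"
      by (cases i; cases j; cases k) (simp_all add: times_linear_def F_def algebra_simps)
    also have "times_linear 1 1 1 (kernel_candidate a n v) i j k = 0"
    proof (cases "k = 0")
      case True
      then have "b \<le> i" using box deg by simp
      then obtain t where t: "i = b + t" using le_Suc_ex by blast
      then have "power_coefficient a v (Suc n) i = 0"
        using path_matrix_mult_vec[of t a b c v] w(3) box by (simp add: w_eq n)
      then show ?thesis using deg n box by (subst times_linear_kernel_candidate) simp_all
    qed (use deg n box in \<open>subst times_linear_kernel_candidate, simp_all\<close>)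
    finally show ?thesis by simp
  qed
  then have "F s (a - 1 - s) n = 0"
    by (rule middle_injectiveD[OF inj, where F = F]) (use s n pos in simp_all)
  then show False
    using s middle_injective_nonzero[OF inj pos]
    by (simp add: F_def kernel_candidate_def power_coefficient_0)
qed

text \<open>
  A kernel element is the kernel candidate of its top coefficient, and its equations at \<open>k = 0\<close> say that this
  coefficient is in the kernel of the matrix.
\<close>
lemma det_nonzero_imp_middle_injective:
  assumes det: "det (path_matrix a b c :: 'k::field mat) \<noteq> 0" and pos: "a > 0" "b > 0" "c > 0"
  shows "middle_injective a b c 1 1 (1 :: 'k)"
  unfolding middle_injective_def
proof (intro allI impI)
  let ?M = "path_matrix a b c :: 'k mat"
  obtain n where n: "b + c = Suc n" using pos by (cases "b + c") auto
  fix F :: "nat \<Rightarrow> nat \<Rightarrow> nat \<Rightarrow> 'k" and i j k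
  assume ker: "\<forall>i j k. i < a + b \<longrightarrow> j < a + c \<longrightarrow> k < b + c \<longrightarrow> i + j + k + 1 = a + b + c \<longrightarrow>
      times_linear 1 1 1 F i j k = 0"
    and ijk: "i < a + b" "j < a + c" "k < b + c" "i + j + k + 2 = a + b + c"
  define v where "v s = F s (a - 1 - s) n" for s
  have F: "F i j k = kernel_candidate a n v i j k"
    if "i < a + b" "j < a + c" "k < b + c" "i + j + k + 2 = a + b + c" for i j k
    unfolding v_def using that n ker
    by (intro kernel_candidate_unique[where l = "a + b" and m = "a + c"]) simp_all
  have "power_coefficient a v (b + c) (b + t) = 0" if t: "t < a" for t
  proof -
    have "0 = times_linear 1 1 1 F (b + t) (a + c - 1 - t) 0"
      using ker t pos by simp
    also have "\<dots> = times_linear 1 1 1 (kernel_candidate a n v) (b + t) (a + c - 1 - t) 0"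
      using t pos by (intro times_linear_cong F) linarith+
    also have "\<dots> = (- 1) ^ n * power_coefficient a v (b + c) (b + t)"
      using t n pos by (subst times_linear_kernel_candidate) auto
    finally show ?thesis by simp
  qed
  then have "?M *\<^sub>v vec a v = 0\<^sub>v a"
    by (intro eq_vecI) (simp_all add: path_matrix_mult_vec path_matrix_carrier[THEN carrier_matD(1)]
      del: index_mult_mat_vec)
  then have "vec a v = 0\<^sub>v a"
    using det det_0_iff_vec_prod_zero_field[OF path_matrix_carrier] vec_carrier by blast
  then have "v s = 0" if "s < a" for s using that by (metis index_vec index_zero_vec(1))
  then have "kernel_candidate a n v i j k = 0"
    by (simp add: kernel_candidate_def power_coefficient_def)
  then show "F i j k = 0" using F[OF ijk] by simp
qed

text \<open>
  The equations for multiplication by \<open>x + y + z\<close> with right-hand side \<open>G\<close> are solved from \<open>k = n\<close>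
  downwards, starting with \<open>0\<close> at \<open>k = n\<close>; the argument \<open>r\<close> stands for \<open>n - k\<close>.
\<close>
primrec particular_solution :: "(nat \<Rightarrow> nat \<Rightarrow> nat \<Rightarrow> 'k::comm_ring_1) \<Rightarrow> nat \<Rightarrow> nat \<Rightarrow> nat \<Rightarrow> nat \<Rightarrow> 'k" where
  "particular_solution G n 0 i j = 0"
| "particular_solution G n (Suc r) i j = G i j (n - r) -
     (if i = 0 then 0 else particular_solution G n r (i - 1) j) -
     (if j = 0 then 0 else particular_solution G n r i (j - 1))"

text \<open>
  The particular solution satisfies all equations except those at \<open>k = 0\<close>. A kernel candidate changes
  nothing but the equations at \<open>k = 0\<close>, and as the matrix is invertible it can be chosen to correct them.
\<close>
lemma det_nonzero_imp_middle_surjective: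
  fixes G :: "nat \<Rightarrow> nat \<Rightarrow> nat \<Rightarrow> 'k::field"
  assumes det: "det (path_matrix a b c :: 'k mat) \<noteq> 0" and pos: "a > 0" "b > 0" "c > 0"
  shows "\<exists>F. \<forall>i j k. i < a + b \<longrightarrow> j < a + c \<longrightarrow> k < b + c \<longrightarrow> i + j + k + 1 = a + b + c \<longrightarrow>
      times_linear 1 1 1 F i j k = G i j k"
proof -
  let ?M = "path_matrix a b c :: 'k mat"
  obtain n where n: "b + c = Suc n" using pos by (cases "b + c") auto
  define P where "P i j k = particular_solution G n (n - k) i j" for i j k
  have P: "times_linear 1 1 1 P i j k = G i j k" if "k \<noteq> 0" "k \<le> n" for i j k
  proof -
    have "n - (k - 1) = Suc (n - k)" "n - (n - k) = k" using that by auto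
    then show ?thesis using that by (simp add: times_linear_def P_def)
  qed
  define R where "R t = (- 1) ^ n * (G (b + t) (a + c - 1 - t) 0 -
      times_linear 1 1 1 P (b + t) (a + c - 1 - t) 0)" for t
  obtain B where B: "B \<in> carrier_mat a a" "?M * B = 1\<^sub>m a"
    using det_non_zero_imp_unit[OF path_matrix_carrier det, of "()"]
    by (auto simp: Units_def ring_mat_def)
  define w where "w = B *\<^sub>v vec a R"
  have w: "w \<in> carrier_vec a" using B by (simp add: w_def)
  define v where "v s = w $ s" for s
  have w_eq: "w = vec a v" using w by (intro eq_vecI) (simp_all add: v_def)
  have "?M *\<^sub>v w = ?M * B *\<^sub>v vec a R"
    unfolding w_def by (rule assoc_mult_mat_vec[symmetric, OF path_matrix_carrier B(1)]) simp
  then have "?M *\<^sub>v w = vec a R" using B(2) by simp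
  then have v: "power_coefficient a v (b + c) (b + t) = R t" if "t < a" for t
    using path_matrix_mult_vec[OF that, of b c v] that by (simp add: w_eq)
  define F where "F i j k = P i j k + kernel_candidate a n v i j k" for i j k
  have F: "times_linear 1 1 1 F i j k =
      times_linear 1 1 1 P i j k + times_linear 1 1 1 (kernel_candidate a n v) i j k" for i j k
    by (simp add: times_linear_def F_def)
  have "times_linear 1 1 1 F i j k = G i j k"
    if box: "i < a + b" "j < a + c" "k < b + c" and deg: "i + j + k + 1 = a + b + c" for i j k
  proof (cases "k = 0")
    case False
    then show ?thesis using box deg n P[of k i j]
      by (simp add: F times_linear_kernel_candidate)
  next
    case True
    then have "b \<le> i" using box deg by simp
    then obtain t where t: "i = b + t" using le_Suc_ex by blast
    then have j: "j = a + c - 1 - t" and "t < a" using True deg box by auto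
    have "times_linear 1 1 1 (kernel_candidate a n v) i j 0 = (- 1) ^ n * R t"
      using deg n True v[OF \<open>t < a\<close>] by (subst times_linear_kernel_candidate) (auto simp: t)
    also have "\<dots> = G i j 0 - times_linear 1 1 1 P i j 0"
      by (simp add: R_def t j flip: power_mult_distrib mult.assoc)
    finally show ?thesis using True by (simp add: F)
  qed
  then show ?thesis by blast
qed

theorem theorem4p2:
  fixes a b c p :: nat
  assumes "a > 0" and "b > 0" and "c > 0"
    and "prime p"
    and "infinite (UNIV :: 'k::field set)" and "CHAR('k) = p"
  shows "p dvd card (plane_partitions_in_box a b c) \<longleftrightarrow>
    \<not> weak_lefschetz
        (quotient_algebra (pure_powers (a + b) (a + c) (b + c) :: (xyz, 'k) multipoly set))
        (graded_component (pure_powers (a + b) (a + c) (b + c) :: (xyz, 'k) multipoly set))"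
proof -
  let ?e = "box_exponents (a + b) (a + c) (b + c)"
  let ?S = "pure_powers (a + b) (a + c) (b + c) :: (xyz, 'k) multipoly set"
  let ?\<sigma> = "exponents (a + b - 1) (a + c - 1) (b + c - 1)"
  define d where "d = a + b + c - 2"
  have d: "Suc d + 1 = a + b + c" "d + 2 = a + b + c" using assms(1-3) by (auto simp: d_def)
  have degrees: "i + j + k + 1 = a + b + c \<longleftrightarrow> i + j + k = Suc d"
    "i + j + k + 2 = a + b + c \<longleftrightarrow> i + j + k = d" for i j k using d by auto
  have middle: "multiplication_injective (power_ideal ?e) (linear_form \<alpha> \<beta> \<gamma>) d \<longleftrightarrow>
      middle_injective a b c \<alpha> \<beta> \<gamma>" for \<alpha> \<beta> \<gamma> :: 'k
    by (simp only: multiplication_injective_box_iff middle_injective_def degrees)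
  have socle: "?e v = Suc (lookup ?\<sigma> v)" for v
    using assms(1-3) by (cases v) (simp_all add: box_exponents_def)
  have deg: "monomial_degree ?\<sigma> = d + Suc d" using d assms(1-3) by simp
  have "of_nat (card (plane_partitions_in_box a b c)) \<noteq> (0 :: 'k) \<longleftrightarrow>
      weak_lefschetz (quotient_algebra ?S) (graded_component ?S)"
    unfolding det_path_matrix[symmetric] pure_powers_eq_range
  proof
    assume "weak_lefschetz (quotient_algebra (range (\<lambda>v. indet v ^ ?e v) :: (xyz, 'k) multipoly set))
      (graded_component (range (\<lambda>v. indet v ^ ?e v) :: (xyz, 'k) multipoly set))"
    then obtain L :: "(xyz, 'k) multipoly" where
      L: "homogeneous 1 L" "multiplication_injective (power_ideal ?e) L d"
      using weak_lefschetz_imp_middle_injective[OF socle deg] by blast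
    obtain \<alpha> \<beta> \<gamma> where "L = linear_form \<alpha> \<beta> \<gamma>"
      using homogeneous_1_obtains_linear_form[OF L(1)] by blast
    then show "det (path_matrix a b c :: 'k mat) \<noteq> 0"
      using L middle middle_injective_imp_det_nonzero assms(1-3) by blast
  next
    assume det: "det (path_matrix a b c :: 'k mat) \<noteq> 0"
    show "weak_lefschetz (quotient_algebra (range (\<lambda>v. indet v ^ ?e v) :: (xyz, 'k) multipoly set))
      (graded_component (range (\<lambda>v. indet v ^ ?e v) :: (xyz, 'k) multipoly set))"
    proof (rule middle_bijective_imp_weak_lefschetz[OF socle _ homogeneous_linear_form])
      show "multiplication_injective (power_ideal ?e) (linear_form 1 1 (1 :: 'k)) d"
        unfolding middle by (rule det_nonzero_imp_middle_injective[OF det assms(1-3)])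
      show "multiplication_surjective (power_ideal ?e) (linear_form 1 1 (1 :: 'k)) d"
        by (rule multiplication_surjective_boxI)
           (rule det_nonzero_imp_middle_surjective[OF det assms(1-3), unfolded degrees])
    qed (use deg in linarith)
  qed
  then show ?thesis using assms(6) by (auto simp: of_nat_eq_0_iff_char_dvd)
qed

end
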